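(* Let $X=\mathbb{P}^1\times\mathbb{P}^1$ over $\mathbb{C}$, let $Z=\{P_1,\dots,P_s\}\subseteq X$ be a finite set of points and let $I$ be the radical ideal of $Z$. Assume that $$\alpha^{+}(I^{(m+1)})=\alpha^{+}(I^{(m)})+1$$ for some integer $m\geq 1$. Then all points $P_1,\dots,P_s$ lie on a single vertical or horizontal fiber.
   Context: $\mathbb{C}[X]=\mathbb{C}[x_0,x_1;y_0,y_1]$ is the bigraded coordinate ring of $X=\mathbb{P}^1\times\mathbb{P}^1$, and $\mathcal{O}_X(a,b)$ is the line bundle of bi-degree $(a,b)$. For a point $P=([a:b],[c:d])$, $I(P)$ is the prime ideal generated by $bx_0-ax_1$ and $dy_0-cy_1$. For $Z=\{P_1,\dots,P_s\}$ the radical ideal is $I=\bigcap_{i=1}^s I(P_i)$, and its $m$-th symbolic power is $I^{(m)}=\bigcap_{i=1}^s I(P_i)^m$; thus a bi-homogeneous form lies in $I^{(m)}$ exactly when it vanishes to order at least $m$ at each $P_i$. For a non-zero bi-homogeneous ideal $J\subset\mathbb{C}[X]$, $\alpha^{+}(J)$ is the least value of $k_1+k_2$ over all pairs of integers $k_1,k_2\ge 0$ such that $J$ contains a non-zero form of bi-degree $(k_1,k_2)$, i.e. $H^0(\mathcal{O}_X(k_1,k_2)\otimes J)\neq 0$. A vertical fiber is a fiber of the projection $X\to\mathbb{P}^1$ onto the first factor (a curve of bi-degree $(1,0)$); a horizontal fiber is a fiber of the projection onto the second factor (a curve of bi-degree $(0,1)$). *)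

theory Defs
  imports
    "HOL-Computational_Algebra.Computational_Algebra"
    "HOL-Algebra.Ideal_Product"
    "HOL-Algebra.Algebraic_Closure_Type"
begin

text \<open>
  The coordinate ring \<open>\<complex>[x\<^sub>0, x\<^sub>1; y\<^sub>0, y\<^sub>1]\<close> is the iterated polynomial ring
  \<open>\<complex>[x\<^sub>0][x\<^sub>1][y\<^sub>0][y\<^sub>1]\<close>; the innermost indeterminate is \<open>x\<^sub>0\<close>, the outermost one \<open>y\<^sub>1\<close>.
\<close>

type_synonym bipoly = "complex poly poly poly poly"

definition const :: "complex \<Rightarrow> bipoly" where
  "const c = [:[:[:[:c:]:]:]:]"

definition x0 :: bipoly where "x0 = [:[:[:[:0, 1:]:]:]:]"
definition x1 :: bipoly where "x1 = [:[:[:0, 1:]:]:]"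
definition y0 :: bipoly where "y0 = [:[:0, 1:]:]"
definition y1 :: bipoly where "y1 = [:0, 1:]"

text \<open>The coefficient of the monomial \<open>x\<^sub>0\<^sup>i x\<^sub>1\<^sup>j y\<^sub>0\<^sup>k y\<^sub>1\<^sup>l\<close>.\<close>

definition bicoeff :: "bipoly \<Rightarrow> nat \<Rightarrow> nat \<Rightarrow> nat \<Rightarrow> nat \<Rightarrow> complex" where
  "bicoeff F i j k l = poly.coeff (poly.coeff (poly.coeff (poly.coeff F l) k) j) i"

definition bihomogeneous :: "nat \<Rightarrow> nat \<Rightarrow> bipoly \<Rightarrow> bool" where
  "bihomogeneous k1 k2 F \<longleftrightarrow>
     (\<forall>i j k l. bicoeff F i j k l \<noteq> 0 \<longrightarrow> i + j = k1 \<and> k + l = k2)"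

abbreviation bipoly_ring :: "bipoly ring" where
  "bipoly_ring \<equiv> ring_of_type_algebra"

definition proj_rel :: "complex \<times> complex \<Rightarrow> complex \<times> complex \<Rightarrow> bool" where
  "proj_rel u v \<longleftrightarrow> u \<noteq> (0, 0) \<and> v \<noteq> (0, 0) \<and>
     (\<exists>c. c \<noteq> 0 \<and> v = (c * fst u, c * snd u))"

quotient_type proj_line = "complex \<times> complex" / partial: proj_rel
proof (rule part_equivpI)
  show "\<exists>u. proj_rel u u"
    by (rule exI[of _ "(1, 0)"]) (auto simp: proj_rel_def intro: exI[of _ 1])
  show "symp proj_rel"
  proof (rule sympI)
    fix u v :: "complex \<times> complex"
    assume "proj_rel u v"
    then obtain c where "u \<noteq> (0, 0)" "v \<noteq> (0, 0)" "c \<noteq> 0" "v = (c * fst u, c * snd u)"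
      unfolding proj_rel_def by blast
    then show "proj_rel v u"
      unfolding proj_rel_def by (intro conjI exI[of _ "inverse c"])
        (auto simp: prod_eq_iff mult.assoc[symmetric])
  qed
  show "transp proj_rel"
  proof (rule transpI)
    fix u v w :: "complex \<times> complex"
    assume "proj_rel u v" "proj_rel v w"
    then obtain c d where "u \<noteq> (0, 0)" "w \<noteq> (0, 0)" "c \<noteq> 0" "d \<noteq> 0"
      "v = (c * fst u, c * snd u)" "w = (d * fst v, d * snd v)"
      unfolding proj_rel_def by blast
    then show "proj_rel u w"
      unfolding proj_rel_def by (intro conjI exI[of _ "d * c"]) auto
  qed
qed

lemma genideal_scale_subset:
  assumes "c \<noteq> 0" "e \<noteq> 0"
  shows "Idl\<^bsub>bipoly_ring\<^esub> {const c * u, const e * v} \<subseteq> Idl\<^bsub>bipoly_ring\<^esub> {u, v}"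
proof -
  interpret R: ring bipoly_ring
    by (rule ring_from_type_algebra)
  have sub: "{u, v} \<subseteq> carrier bipoly_ring"
    by (simp add: ring_of_type_algebra_def)
  have id: "ideal (Idl\<^bsub>bipoly_ring\<^esub> {u, v}) bipoly_ring"
    by (rule R.genideal_ideal[OF sub])
  have "u \<in> Idl\<^bsub>bipoly_ring\<^esub> {u, v}" "v \<in> Idl\<^bsub>bipoly_ring\<^esub> {u, v}"
    using R.genideal_self[OF sub] by auto
  then have "const c * u \<in> Idl\<^bsub>bipoly_ring\<^esub> {u, v}" "const e * v \<in> Idl\<^bsub>bipoly_ring\<^esub> {u, v}"
    using ideal.I_l_closed[OF id] by (auto simp: ring_of_type_algebra_def)
  then show ?thesis
    by (intro R.genideal_minimal[OF id]) auto
qed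

lemma const_mult: "const (a * b) = const a * const b"
  by (simp add: const_def)

lemma const_one: "const 1 = 1"
  by (simp add: const_def one_pCons)

lemma genideal_scale:
  assumes "c \<noteq> 0" "e \<noteq> 0"
  shows "Idl\<^bsub>bipoly_ring\<^esub> {const c * u, const e * v} = Idl\<^bsub>bipoly_ring\<^esub> {u, v}"
proof
  have *: "const (inverse d) * (const d * w) = w" if "d \<noteq> 0" for d w
    using that by (simp add: const_one flip: mult.assoc const_mult)
  show "Idl\<^bsub>bipoly_ring\<^esub> {u, v} \<subseteq> Idl\<^bsub>bipoly_ring\<^esub> {const c * u, const e * v}"
    using genideal_scale_subset[of "inverse c" "inverse e" "const c * u" "const e * v"] assms
    by (simp add: *)
qed (rule genideal_scale_subset[OF assms])

lift_definition point_ideal :: "proj_line \<Rightarrow> proj_line \<Rightarrow> bipoly set" is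
  "\<lambda>(a, b) (c, d).
     Idl\<^bsub>bipoly_ring\<^esub> {const b * x0 - const a * x1, const d * y0 - const c * y1}"
proof -
  fix p p' q q' :: "complex \<times> complex"
  assume "proj_rel p p'" "proj_rel q q'"
  then obtain s t where st: "s \<noteq> 0" "t \<noteq> 0"
      "p' = (s * fst p, s * snd p)" "q' = (t * fst q, t * snd q)"
    unfolding proj_rel_def by blast
  obtain a b c d where [simp]: "p = (a, b)" "q = (c, d)"
    by fastforce
  have "const (s * b) * x0 - const (s * a) * x1 = const s * (const b * x0 - const a * x1)"
       "const (t * d) * y0 - const (t * c) * y1 = const t * (const d * y0 - const c * y1)"
    by (simp_all only: const_mult right_diff_distrib mult.assoc)
  then show "(case p of (a, b) \<Rightarrow> \<lambda>(c, d).
        Idl\<^bsub>bipoly_ring\<^esub> {const b * x0 - const a * x1, const d * y0 - const c * y1}) q =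
      (case p' of (a, b) \<Rightarrow> \<lambda>(c, d).
        Idl\<^bsub>bipoly_ring\<^esub> {const b * x0 - const a * x1, const d * y0 - const c * y1}) q'"
    by (simp add: st(3,4) genideal_scale[OF st(1,2)])
qed

text \<open>
  The \<open>m\<close>-th symbolic power of the radical ideal \<open>\<Inter>P\<in>Z. I(P)\<close> of \<open>Z\<close>.  The power \<open>I(P)\<^sup>m\<close> is taken
  in the monoid of ideals, whose multiplication is the ideal product and whose unit is the
  whole ring.
\<close>

definition symbolic_power :: "(proj_line \<times> proj_line) set \<Rightarrow> nat \<Rightarrow> bipoly set" where
  "symbolic_power Z m =
     (\<Inter>P\<in>Z. point_ideal (fst P) (snd P) [^]\<^bsub>ideals_set bipoly_ring\<^esub> m)"

text \<open>
  Only meaningful for a non-zero bi-homogeneous ideal \<open>J\<close>, so that a least value exists.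
\<close>

definition alpha_plus :: "bipoly set \<Rightarrow> nat" where
  "alpha_plus J =
     (LEAST n. \<exists>k1 k2. n = k1 + k2 \<and> (\<exists>F\<in>J. F \<noteq> 0 \<and> bihomogeneous k1 k2 F))"

definition vertical_fiber :: "proj_line \<Rightarrow> (proj_line \<times> proj_line) set" where
  "vertical_fiber p = fst -` {p}"

definition horizontal_fiber :: "proj_line \<Rightarrow> (proj_line \<times> proj_line) set" where
  "horizontal_fiber q = snd -` {q}"

end

(*
  If Z is not contained in a fiber, then alpha^+ grows by at least 2: a form F in I^(m+1) of
  bidegree (k1, k2) yields a non-zero form in I^(m) of total degree at most k1 + k2 - 2.  Indeed, if
  F has an irreducible factor C of bidegree (a, b) with a, b >= 1 and multiplicity m_P at P, then
  Bezout's theorem for C and a partial derivative of C gives sum_P m_P (m_P - 1) <= 2ab - b < 2ab.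
  Hence the sum_P m_P (m_P - 1) / 2 conditions of having multiplicity at least m_P - 1 at every P
  leave a non-zero form of bidegree (a - 1, b - 1), and this form may replace C in F.  Otherwise F is
  a product of fibers, and one can remove two of them: two distinct parallel ones if there are any,
  and else one vertical and one horizontal fiber, both of multiplicity at least m + 1 in F.
*)
theory Submission
  imports Defs
begin

section \<open>Affine plane curves and their multiplicities\<close>

text \<open>Everything happens in one affine chart that contains \<open>Z\<close>, where bidegrees
  become bounds for the degrees in \<open>x\<close> and in \<open>y\<close>; components at infinity
  disappear there, which only lowers these degrees. The multiplicity at a point is read as the order
  in \<open>s\<close> after blowing up, so that its additivity on products, which the exchange of a
  factor needs, is that of the order of a root. The bound \<open>2ab - b\<close> is
  \<open>ab + b(a - 1)\<close>, the intersection number of the bidegrees \<open>(a, b)\<close> and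
  \<open>(a - 1, b)\<close>; the gain of \<open>b\<close> is what makes the conditions strictly
  fewer than the \<open>ab\<close> coefficients of bidegree \<open>(a - 1, b - 1)\<close>. The
  exchange lowers each multiplicity by at most one but the total degree by two. Of Bezout's theorem
  only the upper bound for the sum of the products of multiplicities enters, so a parameter count
  replaces resultants and local intersection numbers.\<close>

definition is_hom :: "('a::comm_ring_1 \<Rightarrow> 'b::comm_ring_1) \<Rightarrow> bool" where
  "is_hom h \<longleftrightarrow> h 0 = 0 \<and> h 1 = 1 \<and> (\<forall>a b. h (a + b) = h a + h b) \<and> (\<forall>a b. h (a * b) = h a * h b)"

lemma is_homD:
  assumes "is_hom h"
  shows "h 0 = 0" "h 1 = 1" "h (a + b) = h a + h b" "h (a * b) = h a * h b"
  using assms by (auto simp: is_hom_def)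

lemma is_hom_uminus: "is_hom h \<Longrightarrow> h (- a) = - h a"
  using is_homD(3)[of h a "- a"] by (simp add: is_homD(1) eq_neg_iff_add_eq_0 add.commute)

lemma is_hom_diff: "is_hom h \<Longrightarrow> h (a - b) = h a - h b"
  using is_homD(3)[of h a "- b"] by (simp add: is_hom_uminus)

lemma is_hom_power: "is_hom h \<Longrightarrow> h (a ^ n) = h a ^ n"
  by (induction n) (auto simp: is_homD)

lemma is_hom_sum: "is_hom h \<Longrightarrow> h (sum f A) = (\<Sum>i\<in>A. h (f i))"
  by (induction A rule: infinite_finite_induct) (auto simp: is_homD)

lemma is_hom_comp: "is_hom g \<Longrightarrow> is_hom h \<Longrightarrow> is_hom (\<lambda>x. g (h x))"
  by (simp add: is_hom_def)

lemma is_hom_id: "is_hom (\<lambda>x. x)"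
  by (simp add: is_hom_def)

definition hom_eval :: "('a::comm_ring_1 \<Rightarrow> 'b::comm_ring_1) \<Rightarrow> 'b \<Rightarrow> 'a poly \<Rightarrow> 'b" where
  "hom_eval h v p = poly (map_poly h p) v"

lemma hom_eval_0 [simp]: "hom_eval h v 0 = 0"
  by (simp add: hom_eval_def)

lemma hom_eval_pCons: "is_hom h \<Longrightarrow> hom_eval h v (pCons a p) = h a + v * hom_eval h v p"
  by (simp add: hom_eval_def map_poly_pCons is_homD)

lemma hom_eval_add: "is_hom h \<Longrightarrow> hom_eval h v (p + q) = hom_eval h v p + hom_eval h v q"
proof (induction p arbitrary: q)
  case (pCons a p)
  then show ?case by (cases q) (auto simp: hom_eval_pCons is_homD algebra_simps)
qed auto

lemma hom_eval_smult: "is_hom h \<Longrightarrow> hom_eval h v (Polynomial.smult c p) = h c * hom_eval h v p"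
  by (induction p) (auto simp: hom_eval_pCons is_homD algebra_simps)

lemma hom_eval_mult: "is_hom h \<Longrightarrow> hom_eval h v (p * q) = hom_eval h v p * hom_eval h v q"
proof (induction p)
  case (pCons a p)
  then show ?case
    by (simp add: hom_eval_pCons hom_eval_add hom_eval_smult is_homD algebra_simps)
qed auto

lemma is_hom_hom_eval: "is_hom h \<Longrightarrow> is_hom (hom_eval h v)"
  unfolding is_hom_def[of "hom_eval h v"]
  by (simp add: hom_eval_add hom_eval_mult one_pCons hom_eval_pCons is_homD)

lemma hom_eval_const: "is_hom h \<Longrightarrow> hom_eval h v [:c:] = h c"
  by (simp add: hom_eval_pCons)

lemma hom_eval_var: "is_hom h \<Longrightarrow> hom_eval h v [:0, 1:] = v"
  by (simp add: hom_eval_pCons is_homD)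

lemma is_hom_hom_eval_comp:
  assumes "is_hom g" "is_hom h"
  shows "g (hom_eval h v p) = hom_eval (\<lambda>c. g (h c)) (g v) p"
  by (induction p) (auto simp: hom_eval_pCons is_hom_comp is_homD assms)

section \<open>Bivariate polynomials and their partial degrees\<close>

type_synonym apoly = "complex poly poly"

definition cf :: "apoly \<Rightarrow> nat \<Rightarrow> nat \<Rightarrow> complex" where
  "cf f i j = poly.coeff (poly.coeff f j) i"

definition emb :: "complex \<Rightarrow> apoly" where "emb c = [:[:c:]:]"

lemma is_hom_emb: "is_hom emb"
  by (simp add: is_hom_def emb_def one_pCons)

lemma cf_add [simp]: "cf (f + g) i j = cf f i j + cf g i j"
  and cf_0 [simp]: "cf 0 i j = 0"
  and cf_sum: "cf (sum w A) i j = (\<Sum>a\<in>A. cf (w a) i j)"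
  and cf_emb_mult [simp]: "cf (emb c * f) i j = c * cf f i j"
  by (simp_all add: cf_def emb_def coeff_sum)

lemma apoly_eqI: "(\<And>i j. cf f i j = cf g i j) \<Longrightarrow> f = g"
  by (simp add: cf_def poly_eq_iff)

definition mon :: "nat \<Rightarrow> nat \<Rightarrow> apoly" where
  "mon i j = Polynomial.monom (Polynomial.monom 1 i) j"

lemma cf_mon: "cf (mon i j) i' j' = (if i = i' \<and> j = j' then 1 else 0)"
  by (auto simp: cf_def mon_def)

lemma mon_altdef: "mon i j = [:[:0, 1:]:] ^ i * [:0, 1:] ^ j"
proof -
  have "[:[:0, 1:]:] ^ i = [:([:0, 1:] :: complex poly) ^ i:]"
    by (induction i) (auto simp: one_pCons)
  then show ?thesis
    by (simp add: mon_def monom_altdef)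
qed

text \<open>\<open>ydeg\<close> and \<open>xdeg\<close> are the degrees in the outer and in the inner indeterminate.\<close>

abbreviation ydeg :: "apoly \<Rightarrow> nat" where "ydeg \<equiv> Polynomial.degree"

definition swap_vars :: "apoly \<Rightarrow> apoly" where
  "swap_vars = hom_eval (hom_eval emb [:0, 1:]) [:[:0, 1:]:]"

definition xdeg :: "apoly \<Rightarrow> nat" where
  "xdeg f = Polynomial.degree (swap_vars f)"

lemma is_hom_swap_vars: "is_hom swap_vars"
  by (simp add: swap_vars_def is_hom_hom_eval is_hom_emb)

lemma swap_vars_pCons: "swap_vars (pCons p f) = map_poly (\<lambda>c. [:c:]) p + [:[:0, 1:]:] * swap_vars f"
proof -
  have "hom_eval emb [:0, 1:] p = map_poly (\<lambda>c. [:c:]) p"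
    by (induction p) (simp_all add: hom_eval_pCons[OF is_hom_emb] map_poly_pCons, simp add: emb_def)
  then show ?thesis
    unfolding swap_vars_def by (simp add: hom_eval_pCons is_hom_hom_eval is_hom_emb)
qed

lemma cf_swap_vars: "cf (swap_vars f) i j = cf f j i"
proof (induction f arbitrary: i)
  case 0
  then show ?case by (simp add: swap_vars_def)
next
  case (pCons p f)
  show ?case
    using pCons.IH by (cases i) (auto simp: swap_vars_pCons cf_def coeff_map_poly)
qed

lemma swap_vars_swap_vars [simp]: "swap_vars (swap_vars f) = f"
  by (rule apoly_eqI) (simp add: cf_swap_vars)

lemma swap_vars_eq_0_iff [simp]: "swap_vars f = 0 \<longleftrightarrow> f = 0"
  using swap_vars_swap_vars[of f] is_homD(1)[OF is_hom_swap_vars] by (auto simp del: swap_vars_swap_vars)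

lemma ydeg_swap_vars [simp]: "ydeg (swap_vars f) = xdeg f"
  by (simp add: xdeg_def)

lemma xdeg_mult: "f \<noteq> 0 \<Longrightarrow> g \<noteq> 0 \<Longrightarrow> xdeg (f * g) = xdeg f + xdeg g"
  by (simp add: is_homD[OF is_hom_swap_vars] degree_mult_eq flip: ydeg_swap_vars)

lemma ydeg_le_iff: "ydeg f \<le> b \<longleftrightarrow> (\<forall>i j. j > b \<longrightarrow> cf f i j = 0)"
proof
  assume "\<forall>i j. j > b \<longrightarrow> cf f i j = 0"
  then show "ydeg f \<le> b"
    by (intro degree_le) (auto simp: cf_def poly_eq_iff)
qed (auto simp: cf_def coeff_eq_0)

lemma xdeg_le_iff: "xdeg f \<le> a \<longleftrightarrow> (\<forall>i j. i > a \<longrightarrow> cf f i j = 0)"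
  using ydeg_le_iff[of "swap_vars f" a] by (auto simp: cf_swap_vars)

lemma degree_coeff_le_xdeg: "Polynomial.degree (poly.coeff f j) \<le> xdeg f"
  using xdeg_le_iff[of f "xdeg f"] by (intro degree_le) (auto simp: cf_def)

lemma apoly_expand:
  assumes "xdeg f \<le> a" "ydeg f \<le> b"
  shows "f = (\<Sum>(i, j)\<in>{..a} \<times> {..b}. emb (cf f i j) * mon i j)"
proof (rule apoly_eqI)
  fix i j
  have "cf (\<Sum>(i, j)\<in>{..a} \<times> {..b}. emb (cf f i j) * mon i j) i j =
      (\<Sum>p\<in>{..a} \<times> {..b}. if p = (i, j) then cf f i j else 0)"
    unfolding cf_sum by (intro sum.cong) (auto simp: cf_mon split: prod.splits)
  also have "\<dots> = (if (i, j) \<in> {..a} \<times> {..b} then cf f i j else 0)"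
    by (subst sum.delta) auto
  also have "\<dots> = cf f i j"
    using assms by (auto simp: xdeg_le_iff ydeg_le_iff not_le)
  finally show "cf f i j = cf (\<Sum>(i, j)\<in>{..a} \<times> {..b}. emb (cf f i j) * mon i j) i j" ..
qed

text \<open>
  \<open>blowup (t, u) f\<close> is \<open>f(t + s, u + y s)\<close> as an element of \<open>\<complex>[y][s]\<close>: one chart of the blow-up
  of the plane at \<open>(t, u)\<close>, in which the order in \<open>s\<close> is the multiplicity of \<open>f\<close> at that point.
\<close>

definition blowup :: "complex \<times> complex \<Rightarrow> apoly \<Rightarrow> apoly" where
  "blowup P = hom_eval (hom_eval emb [:[:fst P:], 1:]) [:[:snd P:], [:0, 1:]:]"

definition vanish :: "complex \<times> complex \<Rightarrow> nat \<Rightarrow> apoly \<Rightarrow> bool" where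
  "vanish P m f \<longleftrightarrow> [:0, 1:] ^ m dvd blowup P f"

definition mult_at :: "complex \<times> complex \<Rightarrow> apoly \<Rightarrow> nat" where
  "mult_at P f = Polynomial.order 0 (blowup P f)"

lemma is_hom_blowup: "is_hom (blowup P)"
  by (simp add: blowup_def is_hom_hom_eval is_hom_emb)

lemma blowup_emb [simp]: "blowup P (emb c) = emb c"
  by (simp add: blowup_def emb_def[of c] hom_eval_const is_hom_hom_eval is_hom_emb)

lemma blowup_x: "blowup P [:[:c, 1:]:] = [:[:fst P + c:], 1:]"
  unfolding blowup_def hom_eval_const[OF is_hom_hom_eval[OF is_hom_emb]]
  by (simp add: hom_eval_pCons[OF is_hom_emb] is_homD[OF is_hom_emb], simp add: emb_def)

lemma blowup_y: "blowup P [:[:c:], 1:] = [:[:snd P + c:], [:0, 1:]:]"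
  unfolding blowup_def
  by (simp add: hom_eval_pCons is_hom_emb is_hom_hom_eval is_homD[OF is_hom_emb] is_homD[OF is_hom_hom_eval[OF is_hom_emb]], simp add: emb_def)

lemma is_hom_poly_poly: "is_hom (\<lambda>f. poly (poly f a) b)"
  by (simp add: is_hom_def)

lemma poly_poly_hom_eval:
  "hom_eval (hom_eval (\<lambda>c. c) x) y f = poly (poly f [:y:]) x"
proof -
  have 1: "hom_eval (\<lambda>c. c) x p = poly p x" for p
    by (simp add: hom_eval_def)
  show ?thesis
    by (induction f) (simp_all add: hom_eval_pCons is_hom_hom_eval is_hom_id, simp add: 1)
qed

lemma poly_poly_blowup:
  "poly (poly (blowup (t, u) f) [:s:]) y = poly (poly f [:u + y * s:]) (t + s)"
proof -
  have "poly (poly (blowup (t, u) f) [:s:]) y =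
     hom_eval (\<lambda>p. poly (poly (hom_eval emb [:[:t:], 1:] p) [:s:]) y) (u + y * s) f"
    unfolding blowup_def
    by (subst is_hom_hom_eval_comp[OF is_hom_poly_poly]) (auto simp: is_hom_hom_eval is_hom_emb ac_simps)
  also have "(\<lambda>p. poly (poly (hom_eval emb [:[:t:], 1:] p) [:s:]) y) = hom_eval (\<lambda>c. c) (t + s)"
    by (rule ext, subst is_hom_hom_eval_comp[OF is_hom_poly_poly]) (auto simp: is_hom_emb emb_def)
  finally show ?thesis by (simp add: poly_poly_hom_eval ac_simps)
qed

text \<open>The condition \<open>x \<noteq> t\<close> keeps the point in the image of the blow-up
  chart at a point with first coordinate \<open>t\<close>.\<close>

lemma exists_poly_poly_nonzero:
  fixes f :: apoly
  assumes "f \<noteq> 0"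
  shows "\<exists>x y. x \<noteq> t \<and> poly (poly f [:y:]) x \<noteq> 0"
proof -
  obtain j where j: "poly.coeff f j \<noteq> 0"
    using assms by (auto simp: poly_eq_iff)
  have "finite ({x. poly (poly.coeff f j) x = 0} \<union> {t})"
    using j by (simp add: poly_roots_finite)
  then obtain x where x: "x \<noteq> t" "poly (poly.coeff f j) x \<noteq> 0"
    using ex_new_if_finite[OF infinite_UNIV_char_0] by (metis (mono_tags, lifting) UnCI insertI1 mem_Collect_eq)
  define g where "g = map_poly (\<lambda>p. poly p x) f"
  have g: "poly g y = poly (poly f [:y:]) x" for y
    unfolding g_def by (induction f) (auto simp: map_poly_pCons)
  have "poly.coeff g j \<noteq> 0"
    using x by (simp add: g_def coeff_map_poly)
  then have "g \<noteq> 0" by auto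
  then obtain y where "poly g y \<noteq> 0"
    using poly_all_0_iff_0 by blast
  with x g show ?thesis by auto
qed

lemma blowup_eq_0_iff [simp]: "blowup P f = 0 \<longleftrightarrow> f = 0"
proof
  assume 0: "blowup P f = 0"
  obtain t u where P: "P = (t, u)" by (cases P)
  show "f = 0"
  proof (rule ccontr)
    assume "f \<noteq> 0"
    then obtain x y where xy: "x \<noteq> t" "poly (poly f [:y:]) x \<noteq> 0"
      using exists_poly_poly_nonzero by blast
    \<comment> \<open>The chart sends \<open>s = x - t\<close> and slope
      \<open>(y - u) / (x - t)\<close> to the point \<open>(x, y)\<close>, so it reaches everything
      off the line \<open>x = t\<close>.\<close>
    have "poly (poly (blowup P f) [:x - t:]) ((y - u) / (x - t)) = poly (poly f [:y:]) x"
      using xy by (simp add: P poly_poly_blowup)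
    with 0 xy show False by simp
  qed
qed (simp add: is_homD[OF is_hom_blowup])

lemma vanish_iff_mult_at: "f \<noteq> 0 \<Longrightarrow> vanish P m f \<longleftrightarrow> m \<le> mult_at P f"
  using order_divides[of 0 m "blowup P f"] by (simp add: vanish_def mult_at_def)

lemma vanish_zero [simp]: "vanish P m 0"
  by (simp add: vanish_def is_homD[OF is_hom_blowup])

lemma vanish_0 [simp]: "vanish P 0 f"
  by (simp add: vanish_def)

lemma vanish_add: "vanish P m f \<Longrightarrow> vanish P m g \<Longrightarrow> vanish P m (f + g)"
  by (simp add: vanish_def is_homD[OF is_hom_blowup])

lemma vanish_uminus: "vanish P m f \<Longrightarrow> vanish P m (- f)"
  by (simp add: vanish_def is_hom_uminus[OF is_hom_blowup])

lemma vanish_sum: "(\<And>i. i \<in> A \<Longrightarrow> vanish P m (w i)) \<Longrightarrow> vanish P m (sum w A)"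
  by (induction A rule: infinite_finite_induct) (auto simp: vanish_add)

lemma vanish_mult: "vanish P m f \<Longrightarrow> vanish P n g \<Longrightarrow> vanish P (m + n) (f * g)"
  by (simp add: vanish_def is_homD[OF is_hom_blowup] power_add mult_dvd_mono)

lemma vanish_mult_left: "vanish P m f \<Longrightarrow> vanish P m (f * g)"
  using vanish_mult[of P m f 0 g] by simp

lemma vanish_mult_right: "vanish P m g \<Longrightarrow> vanish P m (f * g)"
  using vanish_mult[of P 0 f m g] by simp

lemma vanish_mono: "vanish P m f \<Longrightarrow> n \<le> m \<Longrightarrow> vanish P n f"
  unfolding vanish_def by (meson dvd_trans le_imp_power_dvd)

lemma mult_at_mult: "f \<noteq> 0 \<Longrightarrow> g \<noteq> 0 \<Longrightarrow> mult_at P (f * g) = mult_at P f + mult_at P g"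
  by (simp add: mult_at_def is_homD[OF is_hom_blowup] order_mult)

lemma vanish_iff_coeff: "vanish P m f \<longleftrightarrow> (\<forall>k<m. \<forall>j. cf (blowup P f) j k = 0)"
proof -
  have "[:0, 1:] ^ m = (Polynomial.monom 1 m :: apoly)"
    by (simp add: monom_altdef)
  then show ?thesis
    unfolding vanish_def by (simp only: monom_1_dvd_iff') (simp add: cf_def poly_eq_iff)
qed

text \<open>In \<open>t + s\<close> and \<open>u + y s\<close> the exponent of \<open>y\<close>
  never exceeds that of \<open>s\<close>, and this property survives sums and products. Hence order
  \<open>m\<close> costs only \<open>m(m + 1)/2\<close> linear conditions.\<close>

lemma cf_blowup_eq_0:
  assumes "j > k"
  shows "cf (blowup P f) j k = 0"
proof -
  define Q where "Q g \<longleftrightarrow> (\<forall>j k. j > k \<longrightarrow> cf g j k = 0)" for g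
  have add: "Q (g + h)" if "Q g" "Q h" for g h
    using that by (auto simp: Q_def)
  have mult: "Q (g * h)" if g: "Q g" and h: "Q h" for g h
    unfolding Q_def
  proof (intro allI impI)
    fix j k :: nat assume jk: "j > k"
    have "cf (g * h) j k = (\<Sum>l\<le>k. \<Sum>i\<le>j. cf g i l * cf h (j - i) (k - l))"
      by (simp add: cf_def coeff_mult coeff_sum)
    also have "\<dots> = 0"
    proof (intro sum.neutral ballI)
      fix l i assume l: "l \<in> {..k}" and i: "i \<in> {..j}"
      show "cf g i l * cf h (j - i) (k - l) = 0"
      proof (cases "i > l")
        case False
        then have "j - i > k - l" using jk l i by auto
        then show ?thesis using h by (simp add: Q_def)
      qed (use g in \<open>simp add: Q_def\<close>)
    qed
    finally show "cf (g * h) j k = 0" .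
  qed
  have emb: "Q (emb c)" for c
    by (auto simp: Q_def cf_def emb_def coeff_pCons split: nat.splits)
  have "Q (hom_eval emb [:[:fst P:], 1:] p)" for p
  proof (induction p)
    case (pCons c p)
    have "Q [:[:fst P:], 1:]"
      by (auto simp: Q_def cf_def coeff_pCons one_pCons split: nat.splits)
    with pCons show ?case
      unfolding hom_eval_pCons[OF is_hom_emb] by (intro add mult emb) auto
  qed (simp add: Q_def)
  then have "Q (blowup P f)"
    unfolding blowup_def
  proof (induction f)
    case (pCons c p)
    have "Q [:[:snd P:], [:0, 1:]:]"
      by (auto simp: Q_def cf_def coeff_pCons split: nat.splits)
    with pCons show ?case
      unfolding hom_eval_pCons[OF is_hom_hom_eval[OF is_hom_emb]] by (intro add mult) auto
  qed (simp add: Q_def)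
  with assms show ?thesis by (simp add: Q_def)
qed

text \<open>The exponents \<open>(k, j)\<close> of those \<open>y\<^sup>j s\<^sup>k\<close> with \<open>k < m\<close> that can occur in some \<open>blowup P f\<close>.\<close>

definition jets :: "nat \<Rightarrow> (nat \<times> nat) set" where
  "jets m = (SIGMA k:{..<m}. {..k})"

lemma vanish_iff_jets: "vanish P m f \<longleftrightarrow> (\<forall>(k, j)\<in>jets m. cf (blowup P f) j k = 0)"
  unfolding vanish_iff_coeff jets_def
proof safe
  fix k j
  assume *: "\<forall>(k, j)\<in>SIGMA k:{..<m}. {..k}. cf (blowup P f) j k = 0" and "k < m"
  then show "cf (blowup P f) j k = 0"
    by (cases "j \<le> k") (auto simp: cf_blowup_eq_0)
qed auto

lemma finite_jets [simp]: "finite (jets m)"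
  by (simp add: jets_def)

lemma card_jets: "2 * card (jets m) = m * (m + 1)"
proof -
  have "card (jets m) = (\<Sum>k<m. Suc k)"
    by (simp add: jets_def card_SigmaI)
  then show ?thesis
    by (induction m) (auto simp: jets_def card_SigmaI)
qed

text \<open>Gaussian elimination: an equation with a non-zero coefficient is spent on one unknown,
  which leaves one equation and one unknown fewer.\<close>

lemma underdetermined_system:
  fixes M :: "'e \<Rightarrow> 'i \<Rightarrow> 'a::field"
  assumes "finite E" "finite I" "card E < card I"
  shows "\<exists>c. (\<exists>i\<in>I. c i \<noteq> 0) \<and> (\<forall>e\<in>E. (\<Sum>i\<in>I. M e i * c i) = 0)"
  using assms
proof (induction E arbitrary: I M rule: finite_induct)
  case empty
  then have "I \<noteq> {}" by auto
  then show ?case by (intro exI[of _ "\<lambda>_. 1"]) auto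
next
  case (insert e0 E)
  show ?case
  proof (cases "\<forall>i\<in>I. M e0 i = 0")
    case True
    moreover obtain c where "\<exists>i\<in>I. c i \<noteq> 0" "\<forall>e\<in>E. (\<Sum>i\<in>I. M e i * c i) = 0"
      using insert.IH[of I M] insert.prems insert.hyps by auto
    ultimately show ?thesis by (intro exI[of _ c]) simp
  next
    case False
    then obtain i0 where i0: "i0 \<in> I" "M e0 i0 \<noteq> 0" by blast
    define J where "J = I - {i0}"
    have J: "finite J" "card E < card J" "i0 \<notin> J" "I = insert i0 J"
      using insert.prems insert.hyps i0 by (auto simp: J_def)
    \<comment> \<open>Row \<open>e\<close> minus the multiple of row \<open>e0\<close> that cancels
      the unknown \<open>i0\<close>; \<open>r\<close> below is the value that row \<open>e0\<close>
      then forces on \<open>i0\<close>.\<close>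
    define N where "N e i = M e i - M e i0 * M e0 i / M e0 i0" for e i
    from insert.IH[OF J(1,2), of N] obtain c where
      c: "\<exists>i\<in>J. c i \<noteq> 0" "\<And>e. e \<in> E \<Longrightarrow> (\<Sum>i\<in>J. N e i * c i) = 0"
      by blast
    define r where "r = - (\<Sum>i\<in>J. M e0 i * c i) / M e0 i0"
    define c' where "c' = c(i0 := r)"
    have S: "(\<Sum>i\<in>I. M e i * c' i) = M e i0 * r + (\<Sum>i\<in>J. M e i * c i)" for e
    proof -
      have "(\<Sum>i\<in>J. M e i * c' i) = (\<Sum>i\<in>J. M e i * c i)"
        using J(3) by (intro sum.cong) (auto simp: c'_def)
      then show ?thesis
        using J by (simp add: c'_def)
    qed
    have "(\<Sum>i\<in>I. M e0 i * c' i) = 0"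
      using i0 unfolding S by (simp add: r_def)
    moreover have "(\<Sum>i\<in>I. M e i * c' i) = 0" if "e \<in> E" for e
    proof -
      have "(\<Sum>i\<in>J. N e i * c i) = (\<Sum>i\<in>J. M e i * c i) - M e i0 / M e0 i0 * (\<Sum>i\<in>J. M e0 i * c i)"
        unfolding N_def sum_distrib_left sum_subtractf[symmetric]
        by (intro sum.cong) (auto simp: field_simps)
      with c(2)[OF that] show ?thesis
        unfolding S r_def by simp
    qed
    moreover have "\<exists>i\<in>I. c' i \<noteq> 0"
      using c(1) J by (auto simp: c'_def)
    ultimately show ?thesis by blast
  qed
qed

section \<open>Degree estimates\<close>

lemma xdeg_mult_le: "xdeg (f * g) \<le> xdeg f + xdeg g"
  by (simp add: is_homD[OF is_hom_swap_vars] degree_mult_le flip: ydeg_swap_vars)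

lemma xdeg_emb [simp]: "xdeg (emb c) = 0" and ydeg_emb [simp]: "ydeg (emb c) = 0"
proof -
  have "xdeg (emb c) \<le> 0"
    unfolding xdeg_le_iff by (auto simp: cf_def emb_def coeff_pCons split: nat.splits)
  then show "xdeg (emb c) = 0" by simp
qed (simp add: emb_def)

lemma xdeg_sum_le: "(\<And>i. i \<in> A \<Longrightarrow> xdeg (w i) \<le> n) \<Longrightarrow> xdeg (sum w A) \<le> n"
  by (auto simp: xdeg_le_iff cf_sum intro!: sum.neutral)

lemma ydeg_sum_le: "(\<And>i. i \<in> A \<Longrightarrow> ydeg (w i) \<le> n) \<Longrightarrow> ydeg (sum w A) \<le> n"
  by (auto simp: ydeg_le_iff cf_sum intro!: sum.neutral)

lemma xdeg_mult_leI: "xdeg f \<le> a \<Longrightarrow> xdeg g \<le> b \<Longrightarrow> a + b \<le> n \<Longrightarrow> xdeg (f * g) \<le> n"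
  using xdeg_mult_le[of f g] by linarith

lemma ydeg_mult_leI: "ydeg f \<le> a \<Longrightarrow> ydeg g \<le> b \<Longrightarrow> a + b \<le> n \<Longrightarrow> ydeg (f * g) \<le> n"
  using degree_mult_le[of f g] by linarith

lemma xdeg_add_leI: "xdeg f \<le> n \<Longrightarrow> xdeg g \<le> n \<Longrightarrow> xdeg (f + g) \<le> n"
  by (auto simp: xdeg_le_iff)

lemma xdeg_one [simp]: "xdeg 1 = 0"
  using xdeg_emb[of 1] by (simp add: is_homD[OF is_hom_emb])

lemma xdeg_power_leI: "xdeg f \<le> a \<Longrightarrow> a * k \<le> n \<Longrightarrow> xdeg (f ^ k) \<le> n"
proof -
  assume a: "xdeg f \<le> a" "a * k \<le> n"
  have "xdeg (f ^ k) \<le> a * k"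
    by (induction k) (auto intro!: xdeg_mult_leI[OF a(1)])
  with a show ?thesis by simp
qed

lemma ydeg_power_leI: "ydeg f \<le> a \<Longrightarrow> a * k \<le> n \<Longrightarrow> ydeg (f ^ k) \<le> n"
  using degree_power_le[of f k] by (meson dual_order.trans mult_le_mono1)

lemma xdeg_prod_leI: "(\<And>i. i \<in> A \<Longrightarrow> xdeg (w i) \<le> a) \<Longrightarrow> card A * a \<le> n \<Longrightarrow> xdeg (prod w A) \<le> n"
proof -
  assume a: "\<And>i. i \<in> A \<Longrightarrow> xdeg (w i) \<le> a" "card A * a \<le> n"
  have "xdeg (prod w A) \<le> card A * a"
    using a(1)
  proof (induction A rule: infinite_finite_induct)
    case (insert i A)
    then show ?case by (auto intro!: xdeg_mult_leI[of _ a _ "card A * a"])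
  qed auto
  with a show ?thesis by simp
qed

lemma ydeg_prod_leI: "(\<And>i. i \<in> A \<Longrightarrow> ydeg (w i) \<le> a) \<Longrightarrow> card A * a \<le> n \<Longrightarrow> ydeg (prod w A) \<le> n"
proof -
  assume a: "\<And>i. i \<in> A \<Longrightarrow> ydeg (w i) \<le> a" "card A * a \<le> n"
  have "ydeg (prod w A) \<le> card A * a"
    using a(1)
  proof (induction A rule: infinite_finite_induct)
    case (insert i A)
    then show ?case by (auto intro!: ydeg_mult_leI[of _ a _ "card A * a"])
  qed auto
  with a show ?thesis by simp
qed

section \<open>Vertical and horizontal lines of the affine plane\<close>

definition xline :: "complex \<Rightarrow> apoly" where "xline t = [:[:-t, 1:]:]"
definition yline :: "complex \<Rightarrow> apoly" where "yline u = [:[:-u:], 1:]"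

lemma swap_vars_xline: "swap_vars (xline t) = yline t"
  by (simp add: xline_def yline_def swap_vars_pCons map_poly_pCons is_homD[OF is_hom_swap_vars])

lemma xdeg_xline [simp]: "xdeg (xline t) = 1" and ydeg_xline [simp]: "ydeg (xline t) = 0"
  and xdeg_yline [simp]: "xdeg (yline u) = 0" and ydeg_yline [simp]: "ydeg (yline u) = 1"
proof -
  have 2: "swap_vars (yline u) = xline u"
    using swap_vars_swap_vars[of "xline u"] unfolding swap_vars_xline .
  show "xdeg (xline t) = 1" "xdeg (yline u) = 0"
    unfolding xdeg_def swap_vars_xline 2 by (simp_all add: xline_def yline_def)
qed (simp_all add: xline_def yline_def)

lemma xline_nz [simp]: "xline t \<noteq> 0" and yline_nz [simp]: "yline u \<noteq> 0"
  by (simp_all add: xline_def yline_def)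

lemma blowup_xline: "blowup P (xline t) = [:[:fst P - t:], 1:]"
  and blowup_yline: "blowup P (yline u) = [:[:snd P - u:], [:0, 1:]:]"
  by (simp_all add: xline_def yline_def blowup_x blowup_y)

lemma mult_at_xline: "mult_at P (xline t) = (if fst P = t then 1 else 0)"
proof (cases "fst P = t")
  case True
  then show ?thesis
    using order_power_n_n[of "0 :: complex poly" 1] by (simp add: mult_at_def blowup_xline)
qed (simp add: mult_at_def blowup_xline order_0I)

lemma mult_at_yline: "mult_at P (yline u) = (if snd P = u then 1 else 0)"
proof (cases "snd P = u")
  case True
  \<comment> \<open>The blow-up of \<open>yline u\<close> at a point of this line is
    \<open>y s\<close>; the factor \<open>y\<close> is a scalar for the order in
    \<open>s\<close>.\<close>
  have "Polynomial.order 0 (Polynomial.smult [:0, 1:] ([:- 0, 1:] ^ 1 :: apoly)) = 1"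
    by (subst order_smult) (simp, rule order_power_n_n)
  then show ?thesis
    using True by (simp add: mult_at_def blowup_yline)
qed (simp add: mult_at_def blowup_yline order_0I)

lemma mult_at_one [simp]: "mult_at P 1 = 0"
  by (simp add: mult_at_def is_homD[OF is_hom_blowup])

lemma mult_at_power: "f \<noteq> 0 \<Longrightarrow> mult_at P (f ^ n) = n * mult_at P f"
  by (induction n) (auto simp: mult_at_mult)

lemma mult_at_prod: "(\<And>i. i \<in> A \<Longrightarrow> w i \<noteq> 0) \<Longrightarrow> mult_at P (prod w A) = (\<Sum>i\<in>A. mult_at P (w i))"
  by (induction A rule: infinite_finite_induct) (auto simp: mult_at_mult)

text \<open>The translate \<open>f(x + t, y + u)\<close> for \<open>P = (t, u)\<close>: its
  coefficients are the Taylor coefficients of \<open>f\<close> at \<open>P\<close>.\<close>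

definition shift :: "complex \<times> complex \<Rightarrow> apoly \<Rightarrow> apoly" where
  "shift P = hom_eval (hom_eval emb (xline (- fst P))) (yline (- snd P))"

lemma is_hom_shift: "is_hom (shift P)"
  by (simp add: shift_def is_hom_hom_eval is_hom_emb)

lemma shift_emb [simp]: "shift P (emb c) = emb c"
  by (simp add: shift_def emb_def[of c] hom_eval_const is_hom_hom_eval is_hom_emb)

lemma shift_xline: "shift P (xline t) = xline (t - fst P)"
  unfolding shift_def xline_def[of t] hom_eval_const[OF is_hom_hom_eval[OF is_hom_emb]]
  by (simp add: hom_eval_pCons[OF is_hom_emb] is_homD[OF is_hom_emb], simp add: emb_def xline_def)

lemma shift_yline: "shift P (yline u) = yline (u - snd P)"
  unfolding shift_def yline_def[of u]
  by (simp add: hom_eval_pCons is_hom_emb is_hom_hom_eval is_homD[OF is_hom_emb]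
       is_homD[OF is_hom_hom_eval[OF is_hom_emb]], simp add: emb_def yline_def)

lemma mon_lines: "mon i j = xline 0 ^ i * yline 0 ^ j"
  by (simp add: mon_altdef xline_def yline_def)

lemma shift_expand:
  assumes "xdeg f \<le> a" "ydeg f \<le> b"
  shows "shift P f = (\<Sum>(i, j)\<in>{..a} \<times> {..b}. emb (cf f i j) * (xline (- fst P) ^ i * yline (- snd P) ^ j))"
  by (subst apoly_expand[OF assms])
     (simp add: is_hom_sum[OF is_hom_shift] is_homD[OF is_hom_shift] is_hom_power[OF is_hom_shift]
       mon_lines shift_xline shift_yline split_beta)

lemma shift_shift: "shift (- fst P, - snd P) (shift P f) = f"
proof -
  have "shift (- fst P, - snd P) (shift P f) = (\<Sum>(i, j)\<in>{..xdeg f} \<times> {..ydeg f}. emb (cf f i j) * mon i j)"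
    by (subst shift_expand[of f, OF order.refl order.refl])
     (simp add: is_hom_sum[OF is_hom_shift] is_homD[OF is_hom_shift] is_hom_power[OF is_hom_shift]
       mon_lines shift_xline shift_yline split_beta)
  also have "\<dots> = f" using apoly_expand[of f, OF order.refl order.refl] by simp
  finally show ?thesis .
qed

lemma xdeg_shift_le: "xdeg (shift P f) \<le> xdeg f" and ydeg_shift_le: "ydeg (shift P f) \<le> ydeg f"
  by (subst shift_expand[of f, OF order.refl order.refl],
      force intro!: xdeg_sum_le ydeg_sum_le xdeg_mult_leI[OF _ _ order.refl, THEN order.trans]
        ydeg_mult_leI[OF _ _ order.refl, THEN order.trans] xdeg_power_leI ydeg_power_leI)+

text \<open>Since \<open>(x - t)^i (y - u)^j\<close> becomes \<open>s^i (y s)^j\<close>, different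
  Taylor monomials have different images, and Taylor coefficients can be read off the
  blow-up.\<close>

lemma blowup_lines: "blowup P (xline (fst P) ^ i * yline (snd P) ^ j) = mon j (i + j)"
proof -
  have "[:0, [:0, 1:]:] = [:[:0, 1:]:] * ([:0, 1:] :: apoly)" by simp
  then show ?thesis
    by (simp only: is_homD[OF is_hom_blowup] is_hom_power[OF is_hom_blowup]
      blowup_xline blowup_yline diff_self pCons_0_0 power_mult_distrib mon_altdef power_add ac_simps)
qed

lemma blowup_taylor:
  assumes "finite A"
  shows "cf (blowup P (\<Sum>(i, j)\<in>A. emb (c i j) * (xline (fst P) ^ i * yline (snd P) ^ j))) j (i + j) =
     (if (i, j) \<in> A then c i j else 0)"
proof -
  have "cf (blowup P (\<Sum>(i, j)\<in>A. emb (c i j) * (xline (fst P) ^ i * yline (snd P) ^ j))) j (i + j) =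
     (\<Sum>p\<in>A. if p = (i, j) then c i j else 0)"
    by (auto simp: is_hom_sum[OF is_hom_blowup] cf_sum split_beta is_homD(4)[OF is_hom_blowup, of _ "emb _"]
      blowup_lines cf_mon intro!: sum.cong)
  then show ?thesis using assms by (simp add: sum.delta)
qed

text \<open>The coefficients are those of \<open>shift P f\<close>; the ones with
  \<open>i + j < m\<close> are coefficients of the blow-up below \<open>s^m\<close>. The rectangular
  index range keeps both partial degrees under control, as homogenization requires.\<close>

lemma taylor:
  assumes "xdeg f \<le> a" "ydeg f \<le> b" "vanish P m f"
  shows "\<exists>c. f = (\<Sum>(i, j)\<in>{..a} \<times> {..b}. emb (c i j) * (xline (fst P) ^ i * yline (snd P) ^ j)) \<and>
    (\<forall>i j. i \<le> a \<longrightarrow> j \<le> b \<longrightarrow> i + j < m \<longrightarrow> c i j = 0)"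
proof (intro exI conjI allI impI)
  let ?c = "cf (shift P f)"
  have "xdeg (shift P f) \<le> a" "ydeg (shift P f) \<le> b"
    using assms xdeg_shift_le[of P f] ydeg_shift_le[of P f] by auto
  from shift_expand[OF this, of "(- fst P, - snd P)"]
  show *: "f = (\<Sum>(i, j)\<in>{..a} \<times> {..b}. emb (?c i j) * (xline (fst P) ^ i * yline (snd P) ^ j))"
    by (simp add: shift_shift)
  fix i j assume ij: "i \<le> a" "j \<le> b" "i + j < m"
  then have "cf (blowup P f) j (i + j) = 0"
    using assms(3) by (simp add: vanish_iff_coeff)
  then show "?c i j = 0"
    using ij by (subst (asm) *, subst (asm) blowup_taylor) auto
qed

lemma vanish_lines: "vanish P (i + j) (xline (fst P) ^ i * yline (snd P) ^ j)"
  by (subst vanish_iff_mult_at) (auto simp: mult_at_mult mult_at_power mult_at_xline mult_at_yline)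

section \<open>The partial derivative with respect to \<open>x\<close>\<close>

definition xderiv :: "apoly \<Rightarrow> apoly" where "xderiv = map_poly pderiv"

lemma cf_xderiv: "cf (xderiv f) i j = of_nat (Suc i) * cf f (Suc i) j"
  by (simp add: xderiv_def cf_def coeff_map_poly coeff_pderiv)

lemma xderiv_sum: "xderiv (sum w A) = (\<Sum>i\<in>A. xderiv (w i))"
  by (rule apoly_eqI) (simp add: cf_xderiv cf_sum sum_distrib_left)

lemma xderiv_emb_mult: "xderiv (emb c * f) = emb c * xderiv f"
  by (rule apoly_eqI) (simp add: cf_xderiv)

lemma xderiv_lines: "xderiv (xline t ^ i * yline u ^ j) = emb (of_nat i) * (xline t ^ (i - 1) * yline u ^ j)"
proof -
  have pow: "xline t ^ i = [:[:-t, 1:] ^ i:]" for i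
    by (induction i) (auto simp: xline_def one_pCons)
  have yp: "yline u ^ j = map_poly (\<lambda>c. [:c:]) ([:-u, 1:] ^ j)" for j
    by (induction j) (simp_all add: yline_def map_poly_pCons poly_eq_iff coeff_map_poly coeff_pCons split: nat.splits)
  show ?thesis
    unfolding pow
    by (rule apoly_eqI)
      (simp add: xderiv_def cf_def coeff_map_poly yp pderiv_smult pderiv_power emb_def pderiv_pCons)
qed

text \<open>Each Taylor term with \<open>i + j \<ge> m\<close> loses at most one order, and the
  other terms are zero.\<close>

lemma vanish_xderiv:
  assumes "vanish P m f"
  shows "vanish P (m - 1) (xderiv f)"
proof -
  obtain c where c: "f = (\<Sum>(i, j)\<in>{..xdeg f} \<times> {..ydeg f}. emb (c i j) * (xline (fst P) ^ i * yline (snd P) ^ j))"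
    "\<And>i j. i \<le> xdeg f \<Longrightarrow> j \<le> ydeg f \<Longrightarrow> i + j < m \<Longrightarrow> c i j = 0"
    using taylor[OF order.refl order.refl assms] by blast
  have "vanish P (m - 1) (emb (c i j) * (emb (of_nat i) * (xline (fst P) ^ (i - 1) * yline (snd P) ^ j)))"
    if "i \<le> xdeg f" "j \<le> ydeg f" for i j
  proof (cases "i + j < m")
    case True
    then show ?thesis using c(2)[OF that] by (simp add: is_homD[OF is_hom_emb])
  next
    case False
    show ?thesis
      by (intro vanish_mult_right vanish_mono[OF vanish_lines]) (use False in auto)
  qed
  then show ?thesis
    by (subst c(1)) (auto simp: xderiv_sum split_beta xderiv_emb_mult xderiv_lines intro!: vanish_sum)
qed

lemma xdeg_xderiv_le: "xdeg (xderiv f) \<le> xdeg f - 1"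
  using xdeg_le_iff[of f "xdeg f"] by (auto simp: xdeg_le_iff cf_xderiv)

lemma ydeg_xderiv_le: "ydeg (xderiv f) \<le> ydeg f"
  using ydeg_le_iff[of f "ydeg f"] by (auto simp: ydeg_le_iff cf_xderiv)

text \<open>This is characteristic 0: differentiation multiplies coefficients by the non-zero
  numbers \<open>Suc i\<close>.\<close>

lemma xderiv_nz:
  assumes "xdeg f > 0"
  shows "xderiv f \<noteq> 0"
proof
  assume 0: "xderiv f = 0"
  have "xdeg f \<le> 0"
    unfolding xdeg_le_iff
  proof (intro allI impI)
    fix i j :: nat assume "i > 0"
    then show "cf f i j = 0"
      using cf_xderiv[of f "i - 1" j] 0 by (simp flip: of_nat_Suc del: of_nat_Suc)
  qed
  with assms show False by simp
qed

section \<open>Bezout's inequality\<close>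

lemma cf_lincomb_mon:
  assumes "finite A"
  shows "cf (\<Sum>p\<in>A. emb (c p) * mon (fst p) (snd p)) i j = (if (i, j) \<in> A then c (i, j) else 0)"
proof -
  have "cf (\<Sum>p\<in>A. emb (c p) * mon (fst p) (snd p)) i j = (\<Sum>p\<in>A. if p = (i, j) then c (i, j) else 0)"
    unfolding cf_sum by (intro sum.cong) (auto simp: cf_mon)
  then show ?thesis using assms by (simp add: sum.delta)
qed

lemma xdeg_mon [simp]: "xdeg (mon i j) \<le> i" and ydeg_mon [simp]: "ydeg (mon i j) \<le> j"
  by (auto simp: xdeg_le_iff ydeg_le_iff cf_mon)

lemma xdeg_lincomb_mon_le: "(\<And>p. p \<in> A \<Longrightarrow> fst p \<le> n) \<Longrightarrow> xdeg (\<Sum>p\<in>A. emb (c p) * mon (fst p) (snd p)) \<le> n"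
  by (intro xdeg_sum_le xdeg_mult_leI[of _ 0 _ n] order.trans[OF xdeg_mon]) auto

lemma ydeg_lincomb_mon_le: "(\<And>p. p \<in> A \<Longrightarrow> snd p \<le> n) \<Longrightarrow> ydeg (\<Sum>p\<in>A. emb (c p) * mon (fst p) (snd p)) \<le> n"
  by (intro ydeg_sum_le ydeg_mult_leI[of _ 0 _ n] order.trans[OF ydeg_mon]) auto

lemma cf_blowup_sum_emb:
  "cf (blowup P (\<Sum>i\<in>A. emb (c i) * w i)) j k = (\<Sum>i\<in>A. cf (blowup P (w i)) j k * c i)"
  by (simp add: is_hom_sum[OF is_hom_blowup] cf_sum is_homD(4)[OF is_hom_blowup] mult.commute[of "c _"])

text \<open>There are \<open>a * b\<close> unknown coefficients and one linear condition per jet.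
  The truncated \<open>a - 1\<close> and \<open>b - 1\<close> are harmless, as the assumption forces
  \<open>a\<close> and \<open>b\<close> to be positive.\<close>

lemma exists_vanishing:
  assumes "finite Z" "(\<Sum>P\<in>Z. card (jets (n P))) < a * b"
  shows "\<exists>g. g \<noteq> 0 \<and> xdeg g \<le> a - 1 \<and> ydeg g \<le> b - 1 \<and> (\<forall>P\<in>Z. vanish P (n P) g)"
proof -
  define I where "I = {..<a} \<times> {..<b}"
  define E where "E = (SIGMA P:Z. jets (n P))"
  define M where "M e p = cf (blowup (fst e) (mon (fst p) (snd p))) (snd (snd e)) (fst (snd e))"
    for e :: "(complex \<times> complex) \<times> nat \<times> nat" and p
  have "card E < card I"
    using assms by (simp add: E_def I_def)
  moreover have "finite E" "finite I"
    using assms by (auto simp: E_def I_def)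
  ultimately obtain c where c: "\<exists>i\<in>I. c i \<noteq> 0" "\<forall>e\<in>E. (\<Sum>i\<in>I. M e i * c i) = 0"
    using underdetermined_system[of E I M] by blast
  define g where "g = (\<Sum>p\<in>I. emb (c p) * mon (fst p) (snd p))"
  have "g \<noteq> 0"
  proof
    assume g0: "g = 0"
    obtain i j where ij: "(i, j) \<in> I" "c (i, j) \<noteq> 0" using c by auto
    have "cf g i j = c (i, j)"
      unfolding g_def by (subst cf_lincomb_mon) (use \<open>finite I\<close> ij in auto)
    with g0 ij show False by simp
  qed
  moreover have "xdeg g \<le> a - 1" "ydeg g \<le> b - 1"
    unfolding g_def by (rule xdeg_lincomb_mon_le ydeg_lincomb_mon_le; force simp: I_def)+
  moreover have "vanish P (n P) g" if "P \<in> Z" for P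
    unfolding vanish_iff_jets
  proof safe
    fix k j assume "(k, j) \<in> jets (n P)"
    then have "(P, k, j) \<in> E" using that by (simp add: E_def)
    with c(2) have "(\<Sum>i\<in>I. M (P, k, j) i * c i) = 0" by blast
    then show "cf (blowup P g) j k = 0"
      by (simp add: g_def M_def cf_blowup_sum_emb)
  qed
  ultimately show ?thesis by blast
qed

text \<open>The cross term \<open>m * n\<close> is the origin of the local term in Bezout's
  inequality: jets of order \<open>m + n\<close> outnumber the conditions of orders \<open>m\<close>
  and \<open>n\<close> by this amount.\<close>

lemma card_jets_add: "card (jets (m + n)) = card (jets m) + card (jets n) + m * n"
proof -
  have "2 * card (jets (m + n)) = 2 * (card (jets m) + card (jets n) + m * n)"
    by (simp only: distrib_left card_jets) (simp add: algebra_simps)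
  then show ?thesis by simp
qed

text \<open>Leading exponents, with the exponent of \<open>y\<close> compared first, add under
  multiplication. That of \<open>h\<close> lies in the square of side \<open>D\<close>, so the
  leading coefficient of \<open>f * h\<close> sits at a forbidden place.\<close>

lemma no_multiple_avoiding_leading_box:
  fixes f h :: apoly
  assumes "f \<noteq> 0" "xdeg h < D" "ydeg h < D"
    and "\<And>i j. i < D \<Longrightarrow> j < D \<Longrightarrow>
      cf (f * h) (Polynomial.degree (poly.coeff f (ydeg f)) + i) (ydeg f + j) = 0"
  shows "h = 0"
proof (rule ccontr)
  assume "h \<noteq> 0"
  let ?h = "poly.coeff h (ydeg h)"
  have "Polynomial.degree ?h < D"
    using degree_coeff_le_xdeg[of h "ydeg h"] assms by simp
  from assms(4)[OF this assms(3)] show False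
    using \<open>f \<noteq> 0\<close> \<open>h \<noteq> 0\<close> by (simp add: cf_def coeff_mult_degree_sum)
qed

text \<open>Distinct points differ in a coordinate, which gives a line through \<open>Q\<close> that
  misses \<open>P\<close>.\<close>

definition separator :: "complex \<times> complex \<Rightarrow> complex \<times> complex \<Rightarrow> apoly" where
  "separator P Q = (if fst P \<noteq> fst Q then xline (fst Q) else yline (snd Q))"

lemma separator_nz [simp]: "separator P Q \<noteq> 0"
  and xdeg_separator: "xdeg (separator P Q) \<le> 1" and ydeg_separator: "ydeg (separator P Q) \<le> 1"
  by (auto simp: separator_def)

lemma mult_at_separator: "P \<noteq> Q \<Longrightarrow> mult_at P (separator P Q) = 0" "mult_at Q (separator P Q) = 1"
  by (auto simp: separator_def mult_at_xline mult_at_yline prod_eq_iff)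

text \<open>
  Bezout's inequality, by counting. The unknowns are polynomials \<open>A\<close> and \<open>B\<close> of large bounded degree
  and, for each \<open>P\<close>, a jet \<open>V P\<close> of order \<open>m P + n P\<close>; \<open>u P\<close> vanishes to high order at all other
  points. The conditions are \<open>A f + B g + (\<Sum>P. u P * V P) = 0\<close>, with \<open>A\<close> vanishing to order \<open>n P\<close> and
  \<open>B\<close> to order \<open>m P\<close>. Were the inequality false, there would be fewer conditions than unknowns, yet
  every solution is trivial: \<open>A f + B g\<close> vanishes to order \<open>m P + n P\<close>, hence \<open>V = 0\<close> and \<open>f\<close> divides
  \<open>B\<close>. Multiples of \<open>f\<close> are excluded by omitting from \<open>B\<close> the exponents in a translate \<open>box\<close> of a
  square by the leading exponent of \<open>f\<close>.
\<close>

lemma bezout_inequality: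
  fixes f g :: apoly
  assumes f: "prime_elem f" and ndvd: "\<not> f dvd g" and Z: "finite Z"
    and g: "xdeg g \<le> c" "ydeg g \<le> d"
    and m: "\<And>P. P \<in> Z \<Longrightarrow> vanish P (m P) f" and n: "\<And>P. P \<in> Z \<Longrightarrow> vanish P (n P) g"
  shows "(\<Sum>P\<in>Z. m P * n P) \<le> xdeg f * d + ydeg f * c"
proof (rule ccontr)
  assume "\<not> ?thesis"
  then have large: "(\<Sum>P\<in>Z. m P * n P) > xdeg f * d + ydeg f * c" by simp
  have f0: "f \<noteq> 0" using f by auto
  define a where "a = xdeg f"
  define b where "b = ydeg f"
  \<comment> \<open>\<open>R\<close> bounds every order that occurs, and \<open>D - 1\<close> bounds
    both degrees of each \<open>u P * V P\<close>, so that these products fit among the exponents in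
    \<open>EC\<close>.\<close>
  define R where "R = (\<Sum>P\<in>Z. m P + n P)"
  define D where "D = Suc (card Z * R + R)"
  have R: "m P + n P \<le> R" if "P \<in> Z" for P
    unfolding R_def using Z that by (intro member_le_sum) auto
  define u where "u P = (\<Prod>Q\<in>Z - {P}. separator P Q ^ R)" for P
  have u0: "u P \<noteq> 0" for P
    using Z by (simp add: u_def)
  have degu: "xdeg (u P) \<le> card Z * R" "ydeg (u P) \<le> card Z * R" for P
    unfolding u_def using Z
    by (auto intro!: xdeg_prod_leI[of _ _ R] ydeg_prod_leI[of _ _ R] xdeg_power_leI[OF xdeg_separator]
      ydeg_power_leI[OF ydeg_separator] mult_le_mono1 card_mono)
  have uP: "mult_at P (u P) = 0" for P
  proof -
    have "mult_at P (u P) = (\<Sum>Q\<in>Z - {P}. R * mult_at P (separator P Q))"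
      unfolding u_def by (subst mult_at_prod) (auto simp: mult_at_power)
    also have "\<dots> = 0"
      using mult_at_separator(1)[of P] by (intro sum.neutral) fastforce
    finally show ?thesis .
  qed
  have uQ: "vanish Q R (u P)" if "P \<noteq> Q" "Q \<in> Z" for P Q
  proof -
    have "mult_at Q (u P) = (\<Sum>Q'\<in>Z - {P}. mult_at Q (separator P Q' ^ R))"
      unfolding u_def by (subst mult_at_prod) auto
    also have "\<dots> \<ge> mult_at Q (separator P Q ^ R)"
      using that Z by (intro member_le_sum) auto
    finally show ?thesis
      using u0 by (simp add: vanish_iff_mult_at mult_at_power mult_at_separator)
  qed
  define ld where "ld = Polynomial.degree (poly.coeff f b)"
  have ld: "ld \<le> a" unfolding ld_def a_def by (rule degree_coeff_le_xdeg)
  define box where "box = (\<lambda>(i, j). (ld + i, b + j)) ` ({..<D} \<times> {..<D})"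
  have card_box: "card box = D * D"
    unfolding box_def by (subst card_image) (auto intro!: inj_onI)
  define IA where "IA = {..<c + D} \<times> {..<d + D}"
  define IB where "IB = {..<a + D} \<times> {..<b + D} - box"
  define IV where "IV = (SIGMA P:Z. jets (m P + n P))"
  define I where "I = IA <+> (IB <+> IV)"
  define EC where "EC = {..<a + c + D} \<times> {..<b + d + D}"
  define EA where "EA = (SIGMA P:Z. jets (n P))"
  define EB where "EB = (SIGMA P:Z. jets (m P))"
  define E where "E = EC <+> (EA <+> EB)"
  have fin: "finite IA" "finite IB" "finite IV" "finite EC" "finite EA" "finite EB"
    using Z by (auto simp: IA_def IB_def IV_def EC_def EA_def EB_def)
  have fin': "finite I" "finite E"
    using fin by (auto simp: I_def E_def)
  have "box \<subseteq> {..<a + D} \<times> {..<b + D}"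
    using ld by (auto simp: box_def)
  then have "card IB = (a + D) * (b + D) - D * D"
    unfolding IB_def by (subst card_Diff_subset) (auto simp: card_box finite_subset)
  then have cIB: "card IB = a * b + a * D + b * D"
    by (simp add: algebra_simps)
  have cIV: "card IV = card EA + card EB + (\<Sum>P\<in>Z. m P * n P)"
    using Z by (simp add: IV_def EA_def EB_def card_jets_add sum.distrib)
  \<comment> \<open>All terms with \<open>D\<close> cancel:
    \<open>card EC - card IA - card IB\<close> is \<open>a * d + b * c\<close>, while
    \<open>IV\<close> exceeds \<open>EA\<close> and \<open>EB\<close> together by the sum of the
    \<open>m P * n P\<close>.\<close>
  have "card E < card I"
    using large cIB cIV fin unfolding I_def E_def
    by (simp add: card_Plus) (simp add: IA_def EC_def a_def[symmetric] b_def[symmetric] algebra_simps)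
  \<comment> \<open>For a jet \<open>q = (k, j)\<close> this is the Taylor monomial with blow-up
    \<open>y^j s^k\<close>; \<open>j \<le> k\<close> on \<open>jets\<close>, so the subtraction is
    exact.\<close>
  define L where "L P q = xline (fst P) ^ (fst q - snd q) * yline (snd P) ^ (snd q)"
    for P :: "complex \<times> complex" and q :: "nat \<times> nat"
  \<comment> \<open>The contributions of a single unknown to
    \<open>A f + B g + (\<Sum>P. u P * V P)\<close>, and, in \<open>WA\<close> and
    \<open>WB\<close>, to \<open>A\<close> and to \<open>B\<close>; the matrix \<open>M\<close>
    consists of their coefficients.\<close>
  define W where "W = case_sum (\<lambda>p. mon (fst p) (snd p) * f)
     (case_sum (\<lambda>p. mon (fst p) (snd p) * g) (\<lambda>(P, q). u P * L P q))"
  define WA where "WA = case_sum (\<lambda>p. mon (fst p) (snd p))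
     (case_sum (\<lambda>p. 0) (\<lambda>(P, q). 0) :: (nat \<times> nat) + ((complex \<times> complex) \<times> (nat \<times> nat)) \<Rightarrow> apoly)"
  define WB where "WB = case_sum (\<lambda>p::nat \<times> nat. 0)
     (case_sum (\<lambda>p. mon (fst p) (snd p)) (\<lambda>(P, q). 0) :: (nat \<times> nat) + ((complex \<times> complex) \<times> (nat \<times> nat)) \<Rightarrow> apoly)"
  define M where "M = case_sum (\<lambda>p i. cf (W i) (fst p) (snd p))
     (case_sum (\<lambda>(P, q) i. cf (blowup P (WA i)) (snd q) (fst q))
               (\<lambda>(P, q) i. cf (blowup P (WB i)) (snd q) (fst q)))"
  obtain x where x: "\<exists>i\<in>I. x i \<noteq> 0" "\<And>e. e \<in> E \<Longrightarrow> (\<Sum>i\<in>I. M e i * x i) = 0"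
    using underdetermined_system[OF fin'(2,1) \<open>card E < card I\<close>, of M] by blast
  define A where "A = (\<Sum>p\<in>IA. emb (x (Inl p)) * mon (fst p) (snd p))"
  define B where "B = (\<Sum>p\<in>IB. emb (x (Inr (Inl p))) * mon (fst p) (snd p))"
  define V where "V P = (\<Sum>q\<in>jets (m P + n P). emb (x (Inr (Inr (P, q)))) * L P q)" for P
  have sumI: "(\<Sum>i\<in>I. h i) = (\<Sum>p\<in>IA. h (Inl p)) + ((\<Sum>p\<in>IB. h (Inr (Inl p))) +
      (\<Sum>P\<in>Z. \<Sum>q\<in>jets (m P + n P). h (Inr (Inr (P, q)))))" for h :: "_ \<Rightarrow> apoly"
    using fin Z unfolding I_def by (simp add: sum.Plus IV_def sum.Sigma split_beta)
  have SW: "(\<Sum>i\<in>I. emb (x i) * W i) = A * f + B * g + (\<Sum>P\<in>Z. u P * V P)"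
    unfolding sumI W_def A_def B_def V_def
    by (simp add: sum_distrib_left sum_distrib_right mult_ac)
  have SA: "(\<Sum>i\<in>I. emb (x i) * WA i) = A" and SB: "(\<Sum>i\<in>I. emb (x i) * WB i) = B"
    unfolding sumI WA_def WB_def A_def B_def by simp_all
  have A: "vanish P (n P) A" and B: "vanish P (m P) B" if "P \<in> Z" for P
  proof -
    show "vanish P (n P) A"
      unfolding vanish_iff_jets
    proof safe
      fix k j assume "(k, j) \<in> jets (n P)"
      then have "Inr (Inl (P, (k, j))) \<in> E" using that by (auto simp: E_def EA_def)
      from x(2)[OF this] show "cf (blowup P A) j k = 0"
        by (simp add: M_def SA[symmetric] cf_blowup_sum_emb)
    qed
    show "vanish P (m P) B"
      unfolding vanish_iff_jets
    proof safe
      fix k j assume "(k, j) \<in> jets (m P)"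
      then have "Inr (Inr (P, (k, j))) \<in> E" using that by (auto simp: E_def EB_def)
      from x(2)[OF this] show "cf (blowup P B) j k = 0"
        by (simp add: M_def SB[symmetric] cf_blowup_sum_emb)
    qed
  qed
  have dA: "xdeg A \<le> c + D - 1" "ydeg A \<le> d + D - 1" and dB: "xdeg B \<le> a + D - 1" "ydeg B \<le> b + D - 1"
    unfolding A_def B_def
    by (rule xdeg_lincomb_mon_le ydeg_lincomb_mon_le; force simp: IA_def IB_def)+
  have dL: "xdeg (L P q) \<le> R" "ydeg (L P q) \<le> R" if "P \<in> Z" "q \<in> jets (m P + n P)" for P q
  proof -
    have "fst q \<le> R" "snd q \<le> R"
      using that R[of P] by (auto simp: jets_def)
    then have "xdeg (xline (fst P) ^ (fst q - snd q)) \<le> R" "ydeg (yline (snd P) ^ snd q) \<le> R"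
      "xdeg (yline (snd P) ^ snd q) \<le> 0" "ydeg (xline (fst P) ^ (fst q - snd q)) \<le> 0"
      by (auto intro: xdeg_power_leI[of _ 1] ydeg_power_leI[of _ 1] xdeg_power_leI[of _ 0 _ 0, simplified]
        ydeg_power_leI[of _ 0 _ 0, simplified])
    then show "xdeg (L P q) \<le> R" "ydeg (L P q) \<le> R"
      unfolding L_def by (auto intro: xdeg_mult_leI[of _ R _ 0] ydeg_mult_leI[of _ 0 _ R])
  qed
  have dV: "xdeg (V P) \<le> R" "ydeg (V P) \<le> R" if "P \<in> Z" for P
    unfolding V_def using that
    by (auto intro!: xdeg_sum_le ydeg_sum_le xdeg_mult_leI[of _ 0 _ R] ydeg_mult_leI[of _ 0 _ R] dL)
  define T where "T = A * f + B * g + (\<Sum>P\<in>Z. u P * V P)"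
  have "xdeg T \<le> a + c + D - 1"
    unfolding T_def using g dA dB dV degu
    by (intro xdeg_add_leI xdeg_sum_le xdeg_mult_leI[of A "c + D - 1" f a] xdeg_mult_leI[of B "a + D - 1" g c]
       xdeg_mult_leI[of "u _" "card Z * R" _ R]) (auto simp: a_def D_def)
  moreover have "ydeg T \<le> b + d + D - 1"
    unfolding T_def using g dA dB dV degu
    by (intro degree_add_le ydeg_sum_le ydeg_mult_leI[of A "d + D - 1" f b] ydeg_mult_leI[of B "b + D - 1" g d]
       ydeg_mult_leI[of "u _" "card Z * R" _ R]) (auto simp: b_def D_def)
  ultimately have Tout: "cf T i j = 0" if "i \<ge> a + c + D \<or> j \<ge> b + d + D" for i j
    using that unfolding xdeg_le_iff ydeg_le_iff by (auto simp: D_def)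
  have "T = 0"
  proof (rule apoly_eqI)
    fix i j
    show "cf T i j = cf 0 i j"
    proof (cases "i < a + c + D \<and> j < b + d + D")
      case True
      then have "Inl (i, j) \<in> E" by (auto simp: E_def EC_def)
      from x(2)[OF this] have "cf (\<Sum>i\<in>I. emb (x i) * W i) i j = 0"
        by (simp add: M_def cf_sum mult.commute[of "x _"])
      then show ?thesis by (simp only: SW T_def cf_0)
    qed (use Tout in auto)
  qed
  \<comment> \<open>At \<open>P\<close> all summands of \<open>T = 0\<close> other than
    \<open>u P * V P\<close> vanish to order \<open>m P + n P\<close>, and \<open>u P\<close> has
    multiplicity 0 there, so the order falls on \<open>V P\<close>.\<close>
  have V: "vanish P (m P + n P) (V P)" if P: "P \<in> Z" for P
  proof (cases "V P = 0")
    case False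
    have "vanish P (m P + n P) (A * f + B * g)"
      using vanish_mult[OF A m, OF P P] vanish_mult[OF B n, OF P P]
      by (intro vanish_add) (simp_all add: add.commute)
    moreover have "vanish P (m P + n P) (\<Sum>Q\<in>Z - {P}. u Q * V Q)"
      by (intro vanish_sum vanish_mult_left vanish_mono[OF uQ R]) (use P in auto)
    moreover have "u P * V P = - ((A * f + B * g) + (\<Sum>Q\<in>Z - {P}. u Q * V Q))"
      using \<open>T = 0\<close> Z P unfolding T_def
      by (simp add: sum.remove[OF Z P] eq_neg_iff_add_eq_0 algebra_simps)
    ultimately have "vanish P (m P + n P) (u P * V P)"
      by (simp only: vanish_uminus vanish_add)
    then show ?thesis
      using False u0 by (simp add: vanish_iff_mult_at mult_at_mult uP)
  qed simp
  \<comment> \<open>\<open>V P\<close> involves only Taylor monomials of degree below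
    \<open>m P + n P\<close>, all of which the vanishing kills.\<close>
  have xV: "x (Inr (Inr (P, k, j))) = 0" if P: "P \<in> Z" and kj: "(k, j) \<in> jets (m P + n P)" for P k j
  proof -
    let ?J = "(\<lambda>q. (fst q - snd q, snd q)) ` jets (m P + n P)"
    have "V P = (\<Sum>(i, j)\<in>?J. emb (x (Inr (Inr (P, (i + j, j))))) * (xline (fst P) ^ i * yline (snd P) ^ j))"
      unfolding V_def L_def by (subst sum.reindex) (auto simp: inj_on_def jets_def intro!: sum.cong)
    moreover have "cf (blowup P (V P)) j k = 0"
      using V[OF P] kj by (auto simp: vanish_iff_coeff jets_def)
    moreover have "(k - j, j) \<in> ?J" "k - j + j = k" "finite ?J"
      using kj by (auto simp: jets_def image_iff)
    ultimately show ?thesis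
      using blowup_taylor[of ?J P "\<lambda>i j. x (Inr (Inr (P, (i + j, j))))" j "k - j"] by simp
  qed
  have V0: "V P = 0" if "P \<in> Z" for P
    unfolding V_def using xV[OF that]
    by (intro sum.neutral) (auto simp: is_homD[OF is_hom_emb])
  have AB: "A * f = - (B * g)"
    using \<open>T = 0\<close> V0 by (simp add: T_def eq_neg_iff_add_eq_0)
  then have "f dvd B * g" by (metis dvd_minus_iff dvd_triv_right)
  then have "f dvd B"
    using ndvd prime_elem_dvd_mult_iff[OF f] by blast
  then obtain H where H: "B = f * H" by blast
  have "B = 0"
  proof (rule ccontr)
    assume "B \<noteq> 0"
    then have "H \<noteq> 0" using H by auto
    have "H = 0"
    proof (rule no_multiple_avoiding_leading_box[OF f0])
      have "xdeg B = a + xdeg H" "ydeg B = b + ydeg H"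
        unfolding H a_def b_def using f0 \<open>H \<noteq> 0\<close> by (simp_all add: xdeg_mult degree_mult_eq)
      then show "xdeg H < D" "ydeg H < D" using dB D_def by auto
      fix i j assume "i < D" "j < D"
      then have "(ld + i, b + j) \<notin> IB" by (auto simp: IB_def box_def)
      then have "cf B (ld + i) (b + j) = 0"
        unfolding B_def by (subst cf_lincomb_mon) (use fin in auto)
      then show "cf (f * H) (Polynomial.degree (poly.coeff f (ydeg f)) + i) (ydeg f + j) = 0"
        by (simp add: H ld_def b_def)
    qed
    with \<open>H \<noteq> 0\<close> show False by simp
  qed
  with AB f0 have "A = 0" by simp
  have "x (Inl p) = 0" if "p \<in> IA" for p
    using cf_lincomb_mon[OF fin(1), of "\<lambda>p. x (Inl p)" "fst p" "snd p"] that \<open>A = 0\<close> by (simp add: A_def)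
  moreover have "x (Inr (Inl p)) = 0" if "p \<in> IB" for p
    using cf_lincomb_mon[OF fin(2), of "\<lambda>p. x (Inr (Inl p))" "fst p" "snd p"] that \<open>B = 0\<close> by (simp add: B_def)
  ultimately show False
    using x(1) xV by (auto simp: I_def IV_def)
qed

section \<open>Lowering the order of vanishing by one\<close>

text \<open>
  Bezout's inequality for \<open>f\<close> and \<open>xderiv f\<close> bounds the number of conditions by less than the
  dimension \<open>xdeg f * ydeg f\<close> of the space of candidates.
\<close>

lemma exists_adjoint:
  assumes f: "prime_elem f" "xdeg f > 0" "ydeg f > 0" and Z: "finite Z"
  shows "\<exists>g. g \<noteq> 0 \<and> xdeg g \<le> xdeg f - 1 \<and> ydeg g \<le> ydeg f - 1 \<and> (\<forall>P\<in>Z. vanish P (mult_at P f - 1) g)"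
proof -
  have f0: "f \<noteq> 0" using f by auto
  let ?g = "xderiv f"
  have "\<not> f dvd ?g"
  proof
    assume "f dvd ?g"
    then obtain h where h: "?g = f * h" by blast
    with xderiv_nz[OF f(2)] have "h \<noteq> 0" by auto
    then show False
      using xdeg_mult[OF f0, of h] xdeg_xderiv_le[of f] f h by simp
  qed
  then have "(\<Sum>P\<in>Z. mult_at P f * (mult_at P f - 1)) \<le> xdeg f * ydeg f + ydeg f * (xdeg f - 1)"
    using f0 by (intro bezout_inequality[OF f(1) _ Z, of ?g] xdeg_xderiv_le ydeg_xderiv_le vanish_xderiv)
      (simp_all add: vanish_iff_mult_at)
  also have "\<dots> < 2 * (xdeg f * ydeg f)"
    using f by (cases "xdeg f") auto
  \<comment> \<open>Points off the curve have multiplicity 0; there the truncated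
    \<open>0 - 1 = 0\<close> imposes no condition.\<close>
  also have "(\<Sum>P\<in>Z. mult_at P f * (mult_at P f - 1)) = 2 * (\<Sum>P\<in>Z. card (jets (mult_at P f - 1)))"
    unfolding sum_distrib_left card_jets
  proof (intro sum.cong refl)
    fix P show "mult_at P f * (mult_at P f - 1) = (mult_at P f - 1) * (mult_at P f - 1 + 1)"
      by (cases "mult_at P f") auto
  qed
  finally show ?thesis
    by (intro exists_vanishing[OF Z]) simp
qed

section \<open>Prime polynomials of degree zero in one variable\<close>

lemma not_is_unit_lines: "\<not> xline t dvd 1" "\<not> yline t dvd 1"
  by (auto simp: is_unit_poly_iff xline_def yline_def)

lemma is_unit_apolyD: "f dvd 1 \<Longrightarrow> \<exists>c. c \<noteq> 0 \<and> f = emb c"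
  by (auto simp: is_unit_poly_iff emb_def)

lemma ydeg_0_root:
  assumes "ydeg f = 0" "f \<noteq> 0" "\<not> f dvd 1"
  shows "\<exists>t. xline t dvd f"
proof -
  obtain p where p: "f = [:p:]" using assms(1) by (rule degree_eq_zeroE)
  have "Polynomial.degree p \<noteq> 0"
  proof
    assume "Polynomial.degree p = 0"
    then obtain c where "p = [:c:]" by (rule degree_eq_zeroE)
    with assms p show False by (auto simp: is_unit_poly_iff dvd_field_iff)
  qed
  then obtain t where "poly p t = 0"
    using fundamental_theorem_of_algebra[of p] by (auto simp: constant_degree)
  then obtain q where "p = [:-t, 1:] * q"
    unfolding poly_eq_0_iff_dvd by blast
  then have "f = xline t * [:q:]" by (simp add: p xline_def)
  then have "xline t dvd f" by (rule dvdI)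
  then show ?thesis by blast
qed

text \<open>Such a polynomial involves one variable only and has a root, hence a linear factor;
  irreducibility makes the cofactor a unit. Swapping the variables reduces the second case to the
  first.\<close>

lemma prime_elem_line:
  assumes f: "prime_elem f" and "xdeg f = 0 \<or> ydeg f = 0"
  shows "\<exists>c t. c \<noteq> 0 \<and> (f = emb c * xline t \<or> f = emb c * yline t)"
proof -
  have f': "f \<noteq> 0" "\<not> f dvd 1" "irreducible f"
    using f by (auto intro: prime_elem_imp_irreducible)
  have "\<exists>t. xline t dvd f \<or> yline t dvd f"
  proof (cases "ydeg f = 0")
    case False
    have "\<not> swap_vars f dvd 1"
    proof
      assume "swap_vars f dvd 1"
      then obtain h where "1 = swap_vars f * h" by blast
      then have "swap_vars 1 = swap_vars (swap_vars f * h)" by simp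
      then have "swap_vars 1 = f * swap_vars h"
        by (simp only: is_homD(4)[OF is_hom_swap_vars] swap_vars_swap_vars)
      then show False using f'(2) by (simp add: is_homD(2)[OF is_hom_swap_vars] dvd_def)
    qed
    then obtain t where "xline t dvd swap_vars f"
      using ydeg_0_root[of "swap_vars f"] assms False f' by auto
    then obtain h where "swap_vars f = xline t * h" by blast
    then have "swap_vars (swap_vars f) = yline t * swap_vars h"
      by (simp only: is_homD(4)[OF is_hom_swap_vars] swap_vars_xline)
    then have "yline t dvd f" by simp
    then show ?thesis by blast
  qed (use ydeg_0_root f' in blast)
  then obtain t l h where h: "f = l * h" "l = xline t \<or> l = yline t"
    by (metis dvdE)
  with irreducibleD[OF f'(3) h(1)] have "h dvd 1"
    using not_is_unit_lines by blast
  with is_unit_apolyD[OF this] h show ?thesis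
    by (metis mult.commute)
qed

text \<open>Induction along a factorization into primes: either some prime has positive degree in
  both variables, or every prime is a line up to a constant.\<close>

lemma factor_or_lines:
  assumes "f \<noteq> 0"
  shows "(\<exists>p h. f = p * h \<and> prime_elem p \<and> xdeg p > 0 \<and> ydeg p > 0) \<or>
    (\<exists>c V W. c \<noteq> 0 \<and> f = emb c * (\<Prod>t\<in>#V. xline t) * (\<Prod>u\<in>#W. yline u))"
  using assms
proof (induction f rule: prime_divisors_induct)
  case (unit f)
  then obtain c where "c \<noteq> 0" "f = emb c" using is_unit_apolyD by blast
  then show ?case
    by (intro disjI2 exI[of _ c] exI[of _ "{#}"]) auto
next
  case (factor p f)
  have p: "prime_elem p" using factor by auto
  consider "xdeg p > 0" "ydeg p > 0" | "xdeg p = 0 \<or> ydeg p = 0" by auto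
  then show ?case
  proof cases
    case 1
    with p show ?thesis by blast
  next
    case 2
    from prime_elem_line[OF p this] obtain c t where
      c: "c \<noteq> 0" "p = emb c * xline t \<or> p = emb c * yline t" by blast
    have "f \<noteq> 0" using factor by auto
    from factor.IH[OF this] show ?thesis
    proof (elim disjE exE conjE)
      fix p' h assume *: "f = p' * h" "prime_elem p'" "0 < xdeg p'" "0 < ydeg p'"
      then have "p * f = p' * (p * h)" by (simp add: mult_ac)
      with * show ?thesis by blast
    next
      fix c' V W assume *: "c' \<noteq> 0" "f = emb c' * (\<Prod>t\<in>#V. xline t) * (\<Prod>u\<in>#W. yline u)"
      from c(2) show ?thesis
      proof
        assume "p = emb c * xline t"
        with * c show ?thesis
          by (intro disjI2 exI[of _ "c * c'"] exI[of _ "add_mset t V"] exI[of _ W])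
            (simp add: is_homD(4)[OF is_hom_emb] mult_ac)
      next
        assume "p = emb c * yline t"
        with * c show ?thesis
          by (intro disjI2 exI[of _ "c * c'"] exI[of _ V] exI[of _ "add_mset t W"])
            (simp add: is_homD(4)[OF is_hom_emb] mult_ac)
      qed
    qed
  qed
qed auto

lemma emb_eq_0_iff [simp]: "emb c = 0 \<longleftrightarrow> c = 0"
  by (simp add: emb_def)

lemma mult_at_emb [simp]: "c \<noteq> 0 \<Longrightarrow> mult_at P (emb c) = 0"
  by (simp add: mult_at_def order_0I) (simp add: emb_def order_0I)

lemma line_image_nz [simp]: "0 \<notin> xline ` A" "0 \<notin> yline ` A"
  using xline_nz yline_nz by (metis imageE)+

lemma mult_at_prod_lines:
  "mult_at P ((\<Prod>t\<in>#V. xline t) * (\<Prod>u\<in>#W. yline u)) = count V (fst P) + count W (snd P)"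
proof -
  have "mult_at P (\<Prod>t\<in>#V. xline t) = count V (fst P)"
    by (induction V) (auto simp: mult_at_mult mult_at_xline)
  moreover have "mult_at P (\<Prod>u\<in>#W. yline u) = count W (snd P)"
    by (induction W) (auto simp: mult_at_mult mult_at_yline)
  ultimately show ?thesis by (simp add: mult_at_mult)
qed

lemma deg_prod_lines:
  "xdeg ((\<Prod>t\<in>#V. xline t) * (\<Prod>u\<in>#W. yline u)) + ydeg ((\<Prod>t\<in>#V. xline t) * (\<Prod>u\<in>#W. yline u))
    = size V + size W"
proof -
  have "xdeg (\<Prod>t\<in>#V. xline t) = size V" "ydeg (\<Prod>t\<in>#V. xline t) = 0"
    by (induction V) (auto simp: xdeg_mult degree_mult_eq)
  moreover have "xdeg (\<Prod>t\<in>#W. yline t) = 0" "ydeg (\<Prod>t\<in>#W. yline t) = size W"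
    by (induction W) (auto simp: xdeg_mult degree_mult_eq)
  ultimately show ?thesis by (simp add: xdeg_mult degree_mult_eq)
qed

text \<open>No point lies on two distinct parallel lines. Without such a pair, \<open>V\<close> and
  \<open>W\<close> have at most one line each; neither is empty, or all points would lie on one
  line. A point off the line of \<open>W\<close> lies on that of \<open>V\<close>, which alone
  supplies its multiplicity \<open>m + 1\<close>, and symmetrically.\<close>

lemma remove_two_lines:
  fixes V :: "'a multiset" and W :: "'b multiset"
  assumes Z: "\<And>P. P \<in> Z \<Longrightarrow> m + 1 \<le> count V (fst P) + count W (snd P)"
    and nx: "\<And>p. \<exists>P\<in>Z. fst P \<noteq> p" and ny: "\<And>q. \<exists>P\<in>Z. snd P \<noteq> q"
  shows "\<exists>V' W'. size V' + size W' + 2 = size V + size W \<and>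
    (\<forall>P\<in>Z. m \<le> count V' (fst P) + count W' (snd P))"
proof -
  consider (x) a b where "a \<in># V" "b \<in># V" "a \<noteq> b" | (y) a b where "a \<in># W" "b \<in># W" "a \<noteq> b"
    | (xy) "\<And>a b. a \<in># V \<Longrightarrow> b \<in># V \<Longrightarrow> a = b" "\<And>a b. a \<in># W \<Longrightarrow> b \<in># W \<Longrightarrow> a = b"
    by blast
  then show ?thesis
  proof cases
    case x
    then obtain V' where V: "V = add_mset a (add_mset b V')"
      by (metis insert_DiffM insert_noteq_member)
    show ?thesis
      using Z x(3) by (intro exI[of _ V'] exI[of _ W]) (fastforce simp: V split: if_splits)
  next
    case y
    then obtain W' where W: "W = add_mset a (add_mset b W')"
      by (metis insert_DiffM insert_noteq_member)
    show ?thesis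
      using Z y(3) by (intro exI[of _ V] exI[of _ W']) (fastforce simp: W split: if_splits)
  next
    case xy
    have "\<exists>a. a \<in># V"
    proof (rule ccontr)
      assume "\<nexists>a. a \<in># V"
      then have V: "V = {#}" by auto
      have *: "snd P \<in># W" if "P \<in> Z" for P
        using Z[OF that] unfolding V by (simp flip: count_greater_zero_iff)
      obtain P where "P \<in> Z" using nx by blast
      with ny[of "snd P"] * xy(2) show False by metis
    qed
    then obtain a where a: "a \<in># V" by blast
    have "\<exists>b. b \<in># W"
    proof (rule ccontr)
      assume "\<nexists>a. a \<in># W"
      then have W: "W = {#}" by auto
      have *: "fst P \<in># V" if "P \<in> Z" for P
        using Z[OF that] unfolding W by (simp flip: count_greater_zero_iff)
      obtain P where "P \<in> Z" using nx by blast
      with nx[of "fst P"] * xy(1) show False by metis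
    qed
    then obtain b where b: "b \<in># W" by blast
    have V0: "count V p = 0" if "p \<noteq> a" for p
      using xy(1)[OF a, of p] that by (auto simp: count_eq_zero_iff)
    have W0: "count W p = 0" if "p \<noteq> b" for p
      using xy(2)[OF b, of p] that by (auto simp: count_eq_zero_iff)
    have Va: "count V a \<ge> m + 1"
      using ny[of b] Z W0 V0 by (metis add.right_neutral le_zero_eq add_is_0 one_neq_zero)
    have Wb: "count W b \<ge> m + 1"
      using nx[of a] Z V0 W0 by (metis add.left_neutral le_zero_eq add_is_0 one_neq_zero)
    obtain V' W' where V': "V = add_mset a V'" and W': "W = add_mset b W'"
      using a b by (metis insert_DiffM)
    show ?thesis
    proof (intro exI[of _ V'] exI[of _ W'] conjI ballI)
      fix P assume P: "P \<in> Z"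
      show "m \<le> count V' (fst P) + count W' (snd P)"
        using Z[OF P] Va Wb unfolding V' W' by (auto split: if_splits)
    qed (simp add: V' W')
  qed
qed

lemma affine_reduction:
  assumes f: "f \<noteq> 0" and Z: "finite Z" and van: "\<And>P. P \<in> Z \<Longrightarrow> vanish P (m + 1) f"
    and nx: "\<And>p. \<exists>P\<in>Z. fst P \<noteq> p" and ny: "\<And>q. \<exists>P\<in>Z. snd P \<noteq> q"
  shows "\<exists>g. g \<noteq> 0 \<and> xdeg g + ydeg g + 2 \<le> xdeg f + ydeg f \<and> (\<forall>P\<in>Z. vanish P m g)"
  using factor_or_lines[OF f]
proof (elim disjE exE conjE)
  fix p h assume p: "f = p * h" "prime_elem p" "0 < xdeg p" "0 < ydeg p"
  then have nz: "p \<noteq> 0" "h \<noteq> 0" using f by auto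
  obtain g where g: "g \<noteq> 0" "xdeg g \<le> xdeg p - 1" "ydeg g \<le> ydeg p - 1"
    "\<And>P. P \<in> Z \<Longrightarrow> vanish P (mult_at P p - 1) g"
    using exists_adjoint[OF p(2-4) Z] by blast
  show ?thesis
  proof (intro exI[of _ "g * h"] conjI ballI)
    show "xdeg (g * h) + ydeg (g * h) + 2 \<le> xdeg f + ydeg f"
      using g p nz by (simp add: xdeg_mult degree_mult_eq)
    fix P assume "P \<in> Z"
    \<comment> \<open>The exchange costs one order where \<open>p\<close> passes through
      \<open>P\<close> and nothing where it does not.\<close>
    then show "vanish P m (g * h)"
      using van[of P] g(4)[of P] nz g(1) p(1) f by (simp add: vanish_iff_mult_at mult_at_mult)
  qed (use nz g in auto)
next
  fix c V W assume c: "c \<noteq> 0" "f = emb c * (\<Prod>t\<in>#V. xline t) * (\<Prod>u\<in>#W. yline u)"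
  define L where "L V W = (\<Prod>t\<in>#V. xline t) * (\<Prod>u\<in>#W. yline u)" for V W
  have L0: "L V W \<noteq> 0" for V W by (simp add: L_def)
  have f_eq: "f = emb c * L V W" using c by (simp add: L_def mult.assoc)
  have "m + 1 \<le> count V (fst P) + count W (snd P)" if "P \<in> Z" for P
    using van[OF that] c(1) f f_eq L0 mult_at_prod_lines[of P V W]
    by (simp add: vanish_iff_mult_at mult_at_mult flip: L_def)
  from remove_two_lines[of Z, OF this nx ny] obtain V' W' where
    *: "size V' + size W' + 2 = size V + size W" "\<forall>P\<in>Z. m \<le> count V' (fst P) + count W' (snd P)"
    by blast
  show ?thesis
  proof (intro exI[of _ "L V' W'"] conjI ballI)
    show "xdeg (L V' W') + ydeg (L V' W') + 2 \<le> xdeg f + ydeg f"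
      using deg_prod_lines[of V' W'] deg_prod_lines[of V W] * c(1) L0[of V W]
      by (simp add: f_eq xdeg_mult degree_mult_eq flip: L_def)
    fix P assume "P \<in> Z"
    then show "vanish P m (L V' W')"
      using * mult_at_prod_lines[of P V' W'] L0 by (simp add: vanish_iff_mult_at flip: L_def)
  qed (rule L0)
qed

section \<open>From forms on the product of projective lines to the affine plane\<close>

lemma bicoeff_add [simp]: "bicoeff (F + G) i j k l = bicoeff F i j k l + bicoeff G i j k l"
  and bicoeff_diff [simp]: "bicoeff (F - G) i j k l = bicoeff F i j k l - bicoeff G i j k l"
  and bicoeff_0 [simp]: "bicoeff 0 i j k l = 0"
  and bicoeff_sum: "bicoeff (sum w A) i j k l = (\<Sum>a\<in>A. bicoeff (w a) i j k l)"
  and bicoeff_const_mult [simp]: "bicoeff (const c * F) i j k l = c * bicoeff F i j k l"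
  by (simp_all add: bicoeff_def coeff_sum const_def)

lemma bipoly_eqI: "(\<And>i j k l. bicoeff F i j k l = bicoeff G i j k l) \<Longrightarrow> F = G"
  by (simp add: bicoeff_def poly_eq_iff)

lemma is_hom_const: "is_hom const"
  by (simp add: is_hom_def const_def one_pCons)

lemma bicoeff_mult:
  "bicoeff (F * G) i j k l = (\<Sum>l'\<le>l. \<Sum>k'\<le>k. \<Sum>j'\<le>j. \<Sum>i'\<le>i.
     bicoeff F i' j' k' l' * bicoeff G (i - i') (j - j') (k - k') (l - l'))"
  by (simp add: bicoeff_def coeff_mult coeff_sum)

lemma bihomogeneous_mult:
  assumes "bihomogeneous a b F" "bihomogeneous c d G"
  shows "bihomogeneous (a + c) (b + d) (F * G)"
  unfolding bihomogeneous_def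
proof (intro allI impI)
  fix i j k l assume "bicoeff (F * G) i j k l \<noteq> 0"
  then obtain i' j' k' l' where *: "l' \<le> l" "k' \<le> k" "j' \<le> j" "i' \<le> i"
    "bicoeff F i' j' k' l' * bicoeff G (i - i') (j - j') (k - k') (l - l') \<noteq> 0"
    unfolding bicoeff_mult by (elim sum.not_neutral_contains_not_neutral) auto
  then have "i' + j' = a" "k' + l' = b" "(i - i') + (j - j') = c" "(k - k') + (l - l') = d"
    using assms unfolding bihomogeneous_def by (metis mult_not_zero)+
  with * show "i + j = a + c \<and> k + l = b + d" by auto
qed

lemma bihomogeneous_add: "bihomogeneous a b F \<Longrightarrow> bihomogeneous a b G \<Longrightarrow> bihomogeneous a b (F + G)"
  unfolding bihomogeneous_def by (metis add.right_neutral bicoeff_add)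

lemma bihomogeneous_diff: "bihomogeneous a b F \<Longrightarrow> bihomogeneous a b G \<Longrightarrow> bihomogeneous a b (F - G)"
  unfolding bihomogeneous_def by (metis diff_zero diff_self bicoeff_diff)

lemma bihomogeneous_0: "bihomogeneous a b 0"
  by (simp add: bihomogeneous_def)

lemma bihomogeneous_sum: "(\<And>i. i \<in> A \<Longrightarrow> bihomogeneous a b (w i)) \<Longrightarrow> bihomogeneous a b (sum w A)"
  by (induction A rule: infinite_finite_induct) (auto simp: bihomogeneous_add bihomogeneous_0)

lemma bihomogeneous_const: "bihomogeneous 0 0 (const c)"
  by (auto simp: bihomogeneous_def bicoeff_def const_def coeff_pCons split: nat.splits)

lemma bihomogeneous_const_mult: "bihomogeneous a b F \<Longrightarrow> bihomogeneous a b (const c * F)"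
  using bihomogeneous_mult[OF bihomogeneous_const] by fastforce

lemma bihomogeneous_power: "bihomogeneous a b F \<Longrightarrow> bihomogeneous (n * a) (n * b) (F ^ n)"
  using bihomogeneous_const[of 1]
  by (induction n) (auto simp: const_one intro: bihomogeneous_mult)

lemma bihomogeneous_vars: "bihomogeneous 1 0 x0" "bihomogeneous 1 0 x1" "bihomogeneous 0 1 y0" "bihomogeneous 0 1 y1"
  by (auto simp: bihomogeneous_def bicoeff_def x0_def x1_def y0_def y1_def coeff_pCons split: nat.splits)

definition bimon :: "nat \<Rightarrow> nat \<Rightarrow> nat \<Rightarrow> nat \<Rightarrow> bipoly" where
  "bimon i j k l = x0 ^ i * x1 ^ j * y0 ^ k * y1 ^ l"

lemma bicoeff_bimon: "bicoeff (bimon i j k l) i' j' k' l' = (if (i, j, k, l) = (i', j', k', l') then 1 else 0)"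
proof -
  have c: "[:p:] ^ n = [:p ^ n:]" for p :: "'a::comm_ring_1" and n
    by (induction n) (auto simp: one_pCons)
  have "bimon i j k l = Polynomial.monom (Polynomial.monom (Polynomial.monom (Polynomial.monom 1 i) j) k) l"
    unfolding bimon_def x0_def x1_def y0_def y1_def c monom_altdef by (simp add: mult_ac)
  then show ?thesis by (simp add: bicoeff_def)
qed

lemma bihomogeneous_expand:
  assumes "bihomogeneous a b F"
  shows "F = (\<Sum>(i, k)\<in>{..a} \<times> {..b}. const (bicoeff F i (a - i) k (b - k)) * bimon i (a - i) k (b - k))"
    (is "F = ?S")
proof (rule bipoly_eqI)
  fix i j k l
  have *: "bicoeff ?S i j k l = (\<Sum>p\<in>{..a} \<times> {..b}. if p = (i, k) then
      (if j = a - i \<and> l = b - k then bicoeff F i j k l else 0) else 0)"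
    unfolding bicoeff_sum
  proof (intro sum.cong refl)
    fix p assume "p \<in> {..a} \<times> {..b}"
    obtain i' k' where p: "p = (i', k')" by fastforce
    show "bicoeff (case p of (i, k) \<Rightarrow> const (bicoeff F i (a - i) k (b - k)) * bimon i (a - i) k (b - k)) i j k l =
      (if p = (i, k) then if j = a - i \<and> l = b - k then bicoeff F i j k l else 0 else 0)"
      unfolding p by (cases "i' = i"; cases "k' = k") (simp_all add: bicoeff_bimon)
  qed
  also have "\<dots> = bicoeff F i j k l"
  proof (cases "bicoeff F i j k l = 0")
    case False
    then have "i + j = a" "k + l = b" using assms unfolding bihomogeneous_def by blast+
    then show ?thesis by (subst sum.delta) auto
  qed (auto intro!: sum.neutral)
  finally show "bicoeff F i j k l = bicoeff ?S i j k l" ..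
qed

text \<open>
  The affine chart of \<open>\<pp>\<^sup>1 \<times> \<pp>\<^sup>1\<close> in which \<open>x\<^sub>0 - r x\<^sub>1\<close> and \<open>y\<^sub>0 - r y\<^sub>1\<close> are non-zero, so that for
  generic \<open>r\<close> no point of \<open>Z\<close> lies at infinity.
\<close>

definition chart :: "complex \<Rightarrow> bipoly \<Rightarrow> apoly" where
  "chart r = hom_eval (hom_eval (hom_eval (hom_eval emb (1 + emb r * xline 0)) (xline 0))
     (1 + emb r * yline 0)) (yline 0)"

lemma is_hom_chart: "is_hom (chart r)"
  by (simp add: chart_def is_hom_hom_eval is_hom_emb)

lemma chart_simps [simp]:
  "chart r (const c) = emb c" "chart r x0 = 1 + emb r * xline 0" "chart r x1 = xline 0"
  "chart r y0 = 1 + emb r * yline 0" "chart r y1 = yline 0"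
  unfolding chart_def const_def x0_def x1_def y0_def y1_def
  by (simp_all only: hom_eval_const hom_eval_var is_hom_hom_eval is_hom_emb)

lemmas chart_hom = is_homD[OF is_hom_chart] is_hom_diff[OF is_hom_chart] is_hom_power[OF is_hom_chart]
  is_hom_sum[OF is_hom_chart]

lemma degree_chart_le:
  assumes "bihomogeneous a b F"
  shows "xdeg (chart r F) \<le> a" "ydeg (chart r F) \<le> b"
proof -
  have lin: "xdeg (1 + emb r * xline 0) \<le> 1" "xdeg (1 + emb r * yline 0) \<le> 0"
    "ydeg (1 + emb r * xline 0) \<le> 0" "ydeg (1 + emb r * yline 0) \<le> 1"
    by (intro xdeg_add_leI degree_add_le xdeg_mult_leI[of _ 0 _ 1] xdeg_mult_leI[of _ 0 _ 0]
      ydeg_mult_leI[of _ 0 _ 0] ydeg_mult_leI[of _ 0 _ 1]; simp)+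
  have x: "xdeg (chart r (bimon i j k l)) \<le> i + j" for i j k l
    unfolding bimon_def chart_hom chart_simps
    by (rule xdeg_mult_leI[of _ "i + j" _ 0] xdeg_mult_leI[of _ i _ j] xdeg_power_leI[of _ 1] xdeg_power_leI[of _ 0] lin order.refl | simp)+
  have y: "ydeg (chart r (bimon i j k l)) \<le> k + l" for i j k l
    unfolding bimon_def chart_hom chart_simps
    by (rule ydeg_mult_leI[of _ k _ l] ydeg_mult_leI[of _ 0 _ k] ydeg_mult_leI[of _ 0 _ 0]
      ydeg_power_leI[of _ 1] ydeg_power_leI[of _ 0] lin order.refl | simp)+
  show "xdeg (chart r F) \<le> a"
    by (subst bihomogeneous_expand[OF assms], unfold chart_hom chart_simps split_beta)
      (auto intro!: xdeg_sum_le xdeg_mult_leI[of _ 0 _ a] order.trans[OF x])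
  show "ydeg (chart r F) \<le> b"
    by (subst bihomogeneous_expand[OF assms], unfold chart_hom chart_simps split_beta)
      (auto intro!: ydeg_sum_le ydeg_mult_leI[of _ 0 _ b] order.trans[OF y])
qed

definition eval4 :: "complex \<Rightarrow> complex \<Rightarrow> complex \<Rightarrow> complex \<Rightarrow> bipoly \<Rightarrow> complex" where
  "eval4 s t u v F = poly (poly (poly (poly F [:[:[:v:]:]:]) [:[:u:]:]) [:t:]) s"

lemma is_hom_eval4: "is_hom (eval4 s t u v)"
  by (simp add: is_hom_def eval4_def)

lemma eval4_simps [simp]: "eval4 s t u v (const c) = c" "eval4 s t u v x0 = s"
  "eval4 s t u v x1 = t" "eval4 s t u v y0 = u" "eval4 s t u v y1 = v"
  by (simp_all add: eval4_def const_def x0_def x1_def y0_def y1_def)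

lemmas eval4_hom = is_homD[OF is_hom_eval4] is_hom_diff[OF is_hom_eval4] is_hom_power[OF is_hom_eval4]
  is_hom_sum[OF is_hom_eval4]

lemma exists_nonroot:
  fixes q :: "'a::idom poly" and e :: "complex \<Rightarrow> 'a"
  assumes "q \<noteq> 0" "inj e"
  shows "\<exists>c. poly q (e c) \<noteq> 0"
proof (rule ccontr)
  assume "\<nexists>c. poly q (e c) \<noteq> 0"
  then have "range e \<subseteq> {x. poly q x = 0}" by auto
  with poly_roots_finite[OF assms(1)] have "finite (range e)" by (rule rev_finite_subset)
  with finite_imageD[OF this assms(2)] show False
    using infinite_UNIV_char_0 by blast
qed

lemma exists_eval4_nz:
  assumes "F \<noteq> 0"
  shows "\<exists>s t u v. eval4 s t u v F \<noteq> 0"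
proof -
  have "\<exists>v. poly F [:[:[:v:]:]:] \<noteq> 0"
    by (rule exists_nonroot[OF assms]) (auto intro: injI)
  then obtain v where v: "poly F [:[:[:v:]:]:] \<noteq> 0" by blast
  have "\<exists>u. poly (poly F [:[:[:v:]:]:]) [:[:u:]:] \<noteq> 0"
    by (rule exists_nonroot[OF v]) (auto intro: injI)
  then obtain u where u: "poly (poly F [:[:[:v:]:]:]) [:[:u:]:] \<noteq> 0" by blast
  have "\<exists>t. poly (poly (poly F [:[:[:v:]:]:]) [:[:u:]:]) [:t:] \<noteq> 0"
    by (rule exists_nonroot[OF u]) (auto intro: injI)
  then obtain t where t: "poly (poly (poly F [:[:[:v:]:]:]) [:[:u:]:]) [:t:] \<noteq> 0" by blast
  have "\<exists>s. poly (poly (poly (poly F [:[:[:v:]:]:]) [:[:u:]:]) [:t:]) s \<noteq> 0"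
    by (rule exists_nonroot[OF t]) (auto intro: injI)
  then show ?thesis unfolding eval4_def by blast
qed

text \<open>Dividing \<open>s, t\<close> by \<open>s - r t\<close> and \<open>u, v\<close> by
  \<open>u - r v\<close> lands in the chart, and bihomogeneity accounts for the factors taken
  out.\<close>

lemma eval4_chart:
  assumes "bihomogeneous a b F" and "s - r * t \<noteq> 0" "u - r * v \<noteq> 0"
  shows "eval4 s t u v F = (s - r * t) ^ a * (u - r * v) ^ b *
    poly (poly (chart r F) [:v / (u - r * v):]) (t / (s - r * t))"
proof -
  define S U where "S = s - r * t" and "U = u - r * v"
  have SU: "S \<noteq> 0" "U \<noteq> 0" "s = S + r * t" "u = U + r * v" using assms by (auto simp: S_def U_def)
  define ev where "ev f = poly (poly f [:v / U:]) (t / S)" for f :: apoly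
  have ev: "is_hom ev" unfolding ev_def by (rule is_hom_poly_poly)
  have ev_simps: "ev (emb c) = c" "ev (xline 0) = t / S" "ev (yline 0) = v / U" for c
    by (simp_all add: ev_def emb_def xline_def yline_def)
  have mon: "S ^ a * U ^ b * ev (chart r (bimon i (a - i) k (b - k))) = eval4 s t u v (bimon i (a - i) k (b - k))"
    if "i \<le> a" "k \<le> b" for i k
  proof -
    have "S ^ a = S ^ i * S ^ (a - i)" "U ^ b = U ^ k * U ^ (b - k)"
      using that by (simp_all flip: power_add)
    then have "S ^ a * U ^ b * ev (chart r (bimon i (a - i) k (b - k))) =
      (S * (1 + r * (t / S))) ^ i * (S * (t / S)) ^ (a - i) * (U * (1 + r * (v / U))) ^ k * (U * (v / U)) ^ (b - k)"
      unfolding bimon_def chart_hom chart_simps is_homD[OF ev] is_hom_power[OF ev] ev_simps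
      by (simp only: power_mult_distrib mult_ac)
    moreover have "S * (1 + r * (t / S)) = s" "S * (t / S) = t" "U * (1 + r * (v / U)) = u" "U * (v / U) = v"
      using SU by (auto simp: field_simps)
    ultimately show ?thesis by (simp add: bimon_def eval4_hom)
  qed
  define cc where "cc p = bicoeff F (fst p) (a - fst p) (snd p) (b - snd p)" for p
  define bb where "bb p = bimon (fst p) (a - fst p) (snd p) (b - snd p)" for p
  have F: "F = (\<Sum>p\<in>{..a} \<times> {..b}. const (cc p) * bb p)"
    using bihomogeneous_expand[OF assms(1)] by (simp add: split_beta cc_def bb_def)
  have "S ^ a * U ^ b * ev (chart r F) = (\<Sum>p\<in>{..a} \<times> {..b}. cc p * (S ^ a * U ^ b * ev (chart r (bb p))))"
    by (subst F) (simp add: chart_hom is_hom_sum[OF ev] is_homD[OF ev] ev_simps sum_distrib_left mult_ac)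
  also have "\<dots> = (\<Sum>p\<in>{..a} \<times> {..b}. cc p * eval4 s t u v (bb p))"
    by (intro sum.cong refl) (auto simp: bb_def mon)
  also have "\<dots> = eval4 s t u v F"
    by (subst F) (simp add: eval4_hom)
  finally show ?thesis by (simp add: ev_def S_def U_def)
qed

lemma chart_eq_0D:
  assumes "bihomogeneous a b F" "chart r F = 0"
  shows "F = 0"
proof (rule ccontr)
  assume "F \<noteq> 0"
  \<comment> \<open>The forms that define the lines at infinity are non-zero, so multiplying
    \<open>F\<close> by both yields a point off infinity at which \<open>F\<close> does not
    vanish.\<close>
  have eval_N: "eval4 1 0 1 0 (x0 - const r * x1) = 1" "eval4 1 0 1 0 (y0 - const r * y1) = 1"
    by (simp_all add: eval4_hom)
  have "x0 - const r * x1 \<noteq> 0" "y0 - const r * y1 \<noteq> 0"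
    using eval_N by (metis eval4_hom(1) zero_neq_one)+
  with \<open>F \<noteq> 0\<close> have "F * (x0 - const r * x1) * (y0 - const r * y1) \<noteq> 0" by simp
  then obtain s t u v where "eval4 s t u v (F * (x0 - const r * x1) * (y0 - const r * y1)) \<noteq> 0"
    using exists_eval4_nz by blast
  then show False
    using eval4_chart[OF assms(1), of s r t u v] assms(2) by (simp add: eval4_hom)
qed

lemma chart_inj:
  assumes "bihomogeneous a b F" "bihomogeneous a b G" "chart r F = chart r G"
  shows "F = G"
  using chart_eq_0D[OF bihomogeneous_diff[OF assms(1,2)], of r] assms(3) by (simp add: chart_hom)

definition finite_in :: "complex \<Rightarrow> proj_line \<Rightarrow> bool" where
  "finite_in r p \<longleftrightarrow> fst (rep_proj_line p) - r * snd (rep_proj_line p) \<noteq> 0"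

text \<open>Only meaningful if \<open>finite_in r p\<close>; otherwise the denominator is \<open>0\<close>.\<close>

definition coord :: "complex \<Rightarrow> proj_line \<Rightarrow> complex" where
  "coord r p = snd (rep_proj_line p) / (fst (rep_proj_line p) - r * snd (rep_proj_line p))"

lemma rep_proj_line_nz: "rep_proj_line p \<noteq> (0, 0)"
  using Quotient3_rep_reflp[OF Quotient3_proj_line, of p] by (simp add: proj_rel_def)

lemma coord_inj:
  assumes "finite_in r p" "finite_in r q" "coord r p = coord r q"
  shows "p = q"
proof -
  obtain a b c d where ab: "rep_proj_line p = (a, b)" and cd: "rep_proj_line q = (c, d)"
    by fastforce
  have nz: "a - r * b \<noteq> 0" "c - r * d \<noteq> 0" and eq: "b / (a - r * b) = d / (c - r * d)"
    using assms by (auto simp: finite_in_def coord_def ab cd)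
  define k where "k = (c - r * d) / (a - r * b)"
  have d: "d = k * b" and "c - r * d = k * (a - r * b)"
    using nz eq by (auto simp: k_def field_simps)
  then have "c = k * a" by (simp add: algebra_simps)
  then have "proj_rel (rep_proj_line p) (rep_proj_line q)"
    unfolding proj_rel_def
  proof (intro conjI exI[of _ k] rep_proj_line_nz)
    show "k \<noteq> 0" using nz by (simp add: k_def)
    show "rep_proj_line q = (k * fst (rep_proj_line p), k * snd (rep_proj_line p))"
      using d \<open>c = k * a\<close> by (simp only: ab cd fst_conv snd_conv)
  qed
  then show ?thesis
    using Quotient3_rel_rep[OF Quotient3_proj_line] by blast
qed

text \<open>Each point excludes at most one value of \<open>r\<close>. The point with second
  coordinate 0 excludes none, so the value 0 of its quotient does no harm.\<close>

lemma exists_finite_in: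
  assumes "finite A"
  shows "\<exists>r. \<forall>p\<in>A. finite_in r p"
proof -
  have "finite ((\<lambda>p. fst (rep_proj_line p) / snd (rep_proj_line p)) ` A)" using assms by simp
  then obtain r where r: "r \<notin> (\<lambda>p. fst (rep_proj_line p) / snd (rep_proj_line p)) ` A"
    using ex_new_if_finite[OF infinite_UNIV_char_0] by blast
  have "finite_in r p" if "p \<in> A" for p
  proof (cases "snd (rep_proj_line p) = 0")
    case True
    then show ?thesis using rep_proj_line_nz[of p] by (auto simp: finite_in_def prod_eq_iff)
  next
    case False
    have "r \<noteq> fst (rep_proj_line p) / snd (rep_proj_line p)"
      using r that by blast
    with False show ?thesis by (simp add: finite_in_def eq_divide_eq)
  qed
  then show ?thesis by blast
qed

section \<open>Powers of the ideal of a point and orders of vanishing\<close>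

lemma ideal_power_0: "I [^]\<^bsub>ideals_set bipoly_ring\<^esub> (0::nat) = UNIV"
  by (simp add: nat_pow_def ideals_set_def ring_of_type_algebra_def)

lemma ideal_power_Suc: "I [^]\<^bsub>ideals_set bipoly_ring\<^esub> Suc m =
    ideal_prod bipoly_ring (I [^]\<^bsub>ideals_set bipoly_ring\<^esub> m) I"
  by (simp add: nat_pow_def ideals_set_def)

lemma ideal_power_add:
  assumes "F \<in> I [^]\<^bsub>ideals_set bipoly_ring\<^esub> (m::nat)" "G \<in> I [^]\<^bsub>ideals_set bipoly_ring\<^esub> m"
  shows "F + G \<in> I [^]\<^bsub>ideals_set bipoly_ring\<^esub> m"
proof (cases m)
  case (Suc n)
  then show ?thesis
    using ideal_prod.sum[of F bipoly_ring _ I G] assms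
    by (simp only: ideal_power_Suc) (simp add: ring_of_type_algebra_def)
qed (simp only: ideal_power_0 UNIV_I)

lemma ideal_power_monomial:
  assumes "u \<in> I" "v \<in> I" "m \<le> i + j"
  shows "u ^ i * v ^ j * F \<in> I [^]\<^bsub>ideals_set bipoly_ring\<^esub> m"
  using assms(3)
proof (induction m arbitrary: i j)
  case (Suc m)
  have step: "G * w \<in> I [^]\<^bsub>ideals_set bipoly_ring\<^esub> Suc m"
    if "G \<in> I [^]\<^bsub>ideals_set bipoly_ring\<^esub> m" "w \<in> I" for G w
    using ideal_prod.prod[OF that, of bipoly_ring]
    by (simp only: ideal_power_Suc) (simp add: ring_of_type_algebra_def)
  show ?case
  proof (cases i)
    case (Suc i')
    have "u ^ i' * v ^ j * F * u \<in> I [^]\<^bsub>ideals_set bipoly_ring\<^esub> Suc m"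
      using Suc.IH[of i' j] Suc.prems Suc assms by (intro step) auto
    then show ?thesis by (simp add: Suc mult_ac)
  next
    case 0
    then obtain j' where j: "j = Suc j'" using Suc.prems by (cases j) auto
    have "u ^ i * v ^ j' * F * v \<in> I [^]\<^bsub>ideals_set bipoly_ring\<^esub> Suc m"
      using Suc.IH[of i j'] Suc.prems j assms by (intro step) auto
    then show ?thesis by (simp add: j mult_ac)
  qed
qed (simp only: ideal_power_0 UNIV_I)

lemma ideal_power_subset:
  assumes "\<And>F. F \<in> I \<Longrightarrow> vanish P 1 (chart r F)" "F \<in> I [^]\<^bsub>ideals_set bipoly_ring\<^esub> m"
  shows "vanish P m (chart r F)"
  using assms(2)
proof (induction m arbitrary: F)
  case (Suc m)
  from Suc.prems have "F \<in> ideal_prod bipoly_ring (I [^]\<^bsub>ideals_set bipoly_ring\<^esub> m) I"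
    by (simp only: ideal_power_Suc)
  then show ?case
  proof (induction F rule: ideal_prod.induct)
    case (prod i j)
    have "vanish P (m + 1) (chart r i * chart r j)"
      using prod by (intro vanish_mult Suc.IH assms(1))
    then show ?case by (simp add: ring_of_type_algebra_def chart_hom)
  next
    case (sum s1 s2)
    then show ?case by (simp add: ring_of_type_algebra_def chart_hom vanish_add)
  qed
qed simp

definition xgen :: "proj_line \<Rightarrow> bipoly" where
  "xgen p = const (snd (rep_proj_line p)) * x0 - const (fst (rep_proj_line p)) * x1"

definition ygen :: "proj_line \<Rightarrow> bipoly" where
  "ygen p = const (snd (rep_proj_line p)) * y0 - const (fst (rep_proj_line p)) * y1"

lemma point_ideal_eq: "point_ideal p q = Idl\<^bsub>bipoly_ring\<^esub> {xgen p, ygen q}"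
  by (simp add: point_ideal_def xgen_def ygen_def split_beta)

text \<open>In the chart \<open>b x0 - a x1\<close> becomes
  \<open>b (1 + r x) - a x = - (a - r b) (x - b / (a - r b))\<close>.\<close>

lemma chart_gen:
  assumes "finite_in r p"
  shows "chart r (xgen p) = - emb (fst (rep_proj_line p) - r * snd (rep_proj_line p)) * xline (coord r p)"
    and "chart r (ygen p) = - emb (fst (rep_proj_line p) - r * snd (rep_proj_line p)) * yline (coord r p)"
proof -
  let ?s = "fst (rep_proj_line p) - r * snd (rep_proj_line p)"
  have b: "emb (snd (rep_proj_line p)) = emb ?s * emb (coord r p)"
    using assms by (simp add: finite_in_def coord_def flip: is_homD(4)[OF is_hom_emb])
  have a: "emb (fst (rep_proj_line p)) = emb ?s + emb r * emb (snd (rep_proj_line p))"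
    by (simp flip: is_homD(3,4)[OF is_hom_emb])
  have l: "xline t = xline 0 - emb t" "yline t = yline 0 - emb t" for t
    by (simp_all add: xline_def yline_def emb_def)
  show "chart r (xgen p) = - emb ?s * xline (coord r p)" "chart r (ygen p) = - emb ?s * yline (coord r p)"
    unfolding xgen_def ygen_def chart_hom chart_simps l[of "coord r p"] a
    by (simp_all only: b) (simp_all only: ring_distribs mult_ac mult_1_left, simp_all)
qed

lemma ideal_point_ideal: "ideal (point_ideal p q) bipoly_ring"
  unfolding point_ideal_eq
  by (intro ring.genideal_ideal ring_from_type_algebra) (simp add: ring_of_type_algebra_def)

lemma gens_in_point_ideal: "xgen p \<in> point_ideal p q" "ygen q \<in> point_ideal p q"
proof -
  have "{xgen p, ygen q} \<subseteq> point_ideal p q"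
    unfolding point_ideal_eq
    by (intro ring.genideal_self ring_from_type_algebra) (simp add: ring_of_type_algebra_def)
  then show "xgen p \<in> point_ideal p q" "ygen q \<in> point_ideal p q" by auto
qed

lemma point_ideal_mult: "F \<in> point_ideal p q \<Longrightarrow> G * F \<in> point_ideal p q"
  using ideal.I_l_closed[OF ideal_point_ideal, of F p q G] by (simp add: ring_of_type_algebra_def)

text \<open>The forms whose chart vanishes at the point constitute an ideal that contains both
  generators.\<close>

lemma vanish_chart_point_ideal:
  assumes "finite_in r p" "finite_in r q" "F \<in> point_ideal p q"
  shows "vanish (coord r p, coord r q) 1 (chart r F)"
proof -
  let ?K = "{F. vanish (coord r p, coord r q) 1 (chart r F)}"
  have "ideal ?K bipoly_ring"
  proof (rule idealI)
    show "subgroup ?K (add_monoid bipoly_ring)"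
    proof (rule group.subgroupI)
      show "group (add_monoid bipoly_ring)"
        using ring_from_type_algebra abelian_group.a_group ring.is_abelian_group by blast
      fix F assume "F \<in> ?K"
      have "inv\<^bsub>add_monoid bipoly_ring\<^esub> F = - F"
        using ring_from_type_algebra
        by (intro abelian_group.minus_equality[unfolded a_inv_def] ring.is_abelian_group)
           (auto simp: ring_of_type_algebra_def)
      with \<open>F \<in> ?K\<close> show "inv\<^bsub>add_monoid bipoly_ring\<^esub> F \<in> ?K"
        by (simp add: is_hom_uminus[OF is_hom_chart] vanish_uminus)
    qed (auto simp: ring_of_type_algebra_def chart_hom vanish_add intro!: exI[of _ 0])
  qed (auto simp: ring_of_type_algebra_def ring_from_type_algebra[unfolded ring_of_type_algebra_def]
      chart_hom vanish_mult_left vanish_mult_right)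
  moreover have "vanish (coord r p, coord r q) 1 (xline (coord r p))"
    "vanish (coord r p, coord r q) 1 (yline (coord r q))"
    by (simp_all add: vanish_iff_mult_at mult_at_xline mult_at_yline)
  then have "{xgen p, ygen q} \<subseteq> ?K"
    using assms by (auto simp: chart_gen vanish_mult_right simp del: One_nat_def intro!: vanish_uminus)
  ultimately have "Idl\<^bsub>bipoly_ring\<^esub> {xgen p, ygen q} \<subseteq> ?K"
    by (intro ring.genideal_minimal ring_from_type_algebra)
  with assms(3) show ?thesis by (auto simp: point_ideal_eq)
qed

lemma vanish_chart_power:
  assumes "finite_in r p" "finite_in r q" "F \<in> point_ideal p q [^]\<^bsub>ideals_set bipoly_ring\<^esub> m"
  shows "vanish (coord r p, coord r q) m (chart r F)"
  using ideal_power_subset[OF vanish_chart_point_ideal[OF assms(1,2)] assms(3)] .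

text \<open>Homogenizing the Taylor expansion term by term exhibits membership in the power of the
  ideal: every surviving term contains at least \<open>m\<close> factors from the two
  generators.\<close>

lemma homogenization_at_point:
  assumes "xdeg f \<le> a" "ydeg f \<le> b" "finite_in r p" "finite_in r q" "vanish (coord r p, coord r q) m f"
  shows "\<exists>F. bihomogeneous a b F \<and> chart r F = f \<and> F \<in> point_ideal p q [^]\<^bsub>ideals_set bipoly_ring\<^esub> m"
proof -
  obtain c where c: "f = (\<Sum>(i, j)\<in>{..a} \<times> {..b}. emb (c i j) * (xline (coord r p) ^ i * yline (coord r q) ^ j))"
    "\<And>i j. i \<le> a \<Longrightarrow> j \<le> b \<Longrightarrow> i + j < m \<Longrightarrow> c i j = 0"
    using taylor[OF assms(1,2,5)] by auto
  \<comment> \<open>This scaling makes the charts of \<open>u\<close> and \<open>v\<close> exactly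
    \<open>x - coord r p\<close> and \<open>y - coord r q\<close>.\<close>
  define k where "k p = - inverse (fst (rep_proj_line p) - r * snd (rep_proj_line p))" for p
  define u where "u = const (k p) * xgen p"
  define v where "v = const (k q) * ygen q"
  have uv: "u \<in> point_ideal p q" "v \<in> point_ideal p q"
    unfolding u_def v_def by (intro point_ideal_mult gens_in_point_ideal)+
  have k: "emb (k p) * (- emb (fst (rep_proj_line p) - r * snd (rep_proj_line p)) * l) = l" if "finite_in r p" for p l
  proof -
    let ?s = "fst (rep_proj_line p) - r * snd (rep_proj_line p)"
    have "k p * ?s = - 1" using that by (simp add: finite_in_def k_def)
    then have "emb (k p) * emb ?s = - 1"
      by (simp add: is_hom_uminus[OF is_hom_emb] is_homD(2)[OF is_hom_emb] flip: is_homD(4)[OF is_hom_emb])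
    moreover have "emb (k p) * (- emb ?s * l) = - (emb (k p) * emb ?s) * l"
      by (simp only: mult_minus_left mult_minus_right mult.assoc)
    ultimately show ?thesis by simp
  qed
  have chart_uv: "chart r u = xline (coord r p)" "chart r v = yline (coord r q)"
    unfolding u_def v_def chart_hom chart_simps chart_gen[OF assms(3)] chart_gen[OF assms(4)]
    by (rule k; fact)+
  \<comment> \<open>The forms \<open>N\<close> and \<open>N'\<close> equal 1 in the chart; their
    powers pad every term to bidegree \<open>(a, b)\<close>.\<close>
  define N where "N = x0 - const r * x1"
  define N' where "N' = y0 - const r * y1"
  have N: "chart r N = 1" "chart r N' = 1"
    by (simp_all add: N_def N'_def chart_hom)
  have b1: "bihomogeneous 1 0 u" "bihomogeneous 0 1 v" "bihomogeneous 1 0 N" "bihomogeneous 0 1 N'"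
    unfolding u_def v_def N_def N'_def xgen_def ygen_def
    by (intro bihomogeneous_const_mult bihomogeneous_diff bihomogeneous_vars)+
  define h where "h p = const (c (fst p) (snd p)) *
    (u ^ fst p * v ^ snd p * (N ^ (a - fst p) * N' ^ (b - snd p)))" for p
  define F where "F = (\<Sum>p\<in>{..a} \<times> {..b}. h p)"
  have "bihomogeneous a b F"
    unfolding F_def
  proof (rule bihomogeneous_sum)
    fix p assume "p \<in> {..a} \<times> {..b}"
    then obtain i j where "p = (i, j)" "i \<le> a" "j \<le> b" by auto
    moreover have "bihomogeneous ((i * 1 + j * 0) + ((a - i) * 1 + (b - j) * 0)) ((i * 0 + j * 1) + ((a - i) * 0 + (b - j) * 1))
       (u ^ i * v ^ j * (N ^ (a - i) * N' ^ (b - j)))"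
      by (intro bihomogeneous_mult bihomogeneous_power b1)
    ultimately show "bihomogeneous a b (h p)"
      unfolding h_def by (intro bihomogeneous_const_mult) simp
  qed
  moreover have "chart r F = f"
    unfolding F_def c(1) by (simp add: h_def chart_hom split_beta chart_uv N)
  moreover have "F \<in> point_ideal p q [^]\<^bsub>ideals_set bipoly_ring\<^esub> m"
  proof -
    have sum: "(\<And>x. x \<in> A \<Longrightarrow> h x \<in> point_ideal p q [^]\<^bsub>ideals_set bipoly_ring\<^esub> m) \<Longrightarrow>
        sum h A \<in> point_ideal p q [^]\<^bsub>ideals_set bipoly_ring\<^esub> m" for h :: "nat \<times> nat \<Rightarrow> bipoly" and A
      \<comment> \<open>With last factor 0 this says that 0 belongs to the power, which starts the
        induction.\<close>
      using ideal_power_monomial[OF uv, of m m 0 0]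
      by (induction A rule: infinite_finite_induct) (auto simp: ideal_power_add)
    show ?thesis
      unfolding F_def
    proof (rule sum)
      fix w assume "w \<in> {..a} \<times> {..b}"
      then obtain i j where ij: "w = (i, j)" "i \<le> a" "j \<le> b" by auto
      show "h w \<in> point_ideal p q [^]\<^bsub>ideals_set bipoly_ring\<^esub> m"
      proof (cases "i + j < m")
        case True
        then have "h w = 0" using c(2)[of i j] ij by (simp add: h_def is_homD[OF is_hom_const])
        then show ?thesis using ideal_power_monomial[OF uv, of m m 0 0] by simp
      next
        case False
        then have "u ^ i * v ^ j * (const (c i j) * (N ^ (a - i) * N' ^ (b - j))) \<in> point_ideal p q [^]\<^bsub>ideals_set bipoly_ring\<^esub> m"
          by (intro ideal_power_monomial[OF uv]) auto
        then show ?thesis by (simp add: h_def ij mult_ac)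
      qed
    qed
  qed
  ultimately show ?thesis by blast
qed

text \<open>Each point yields its own homogenization inside its ideal power. All have the same chart
  and bidegree, hence coincide by \<open>chart_inj\<close>, and the common form lies in the
  intersection.\<close>

lemma homogenization:
  assumes "xdeg f \<le> a" "ydeg f \<le> b" "Z \<noteq> {}"
    and fin: "\<And>P. P \<in> Z \<Longrightarrow> finite_in r (fst P) \<and> finite_in r (snd P)"
    and van: "\<And>P. P \<in> Z \<Longrightarrow> vanish (coord r (fst P), coord r (snd P)) m f"
  shows "\<exists>F \<in> symbolic_power Z m. bihomogeneous a b F \<and> chart r F = f"
proof -
  have ex: "\<exists>F. bihomogeneous a b F \<and> chart r F = f \<and>
      F \<in> point_ideal (fst P) (snd P) [^]\<^bsub>ideals_set bipoly_ring\<^esub> m" if "P \<in> Z" for P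
    using homogenization_at_point[OF assms(1,2)] fin[OF that] van[OF that] by blast
  obtain P0 where "P0 \<in> Z" using assms(3) by blast
  with ex obtain F where F: "bihomogeneous a b F" "chart r F = f" by blast
  have "F \<in> symbolic_power Z m"
    unfolding symbolic_power_def
  proof (rule INT_I)
    fix P assume "P \<in> Z"
    from ex[OF this] obtain G where G: "bihomogeneous a b G" "chart r G = f"
      "G \<in> point_ideal (fst P) (snd P) [^]\<^bsub>ideals_set bipoly_ring\<^esub> m" by blast
    with F chart_inj[of a b F G r] show "F \<in> point_ideal (fst P) (snd P) [^]\<^bsub>ideals_set bipoly_ring\<^esub> m"
      by simp
  qed
  with F show ?thesis by blast
qed

section \<open>Growth of \<open>alpha_plus\<close> for points outside a single fiber\<close>

theorem theorem3p1:
  fixes Z :: "(proj_line \<times> proj_line) set" and m :: nat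
  assumes "finite Z"
    and "m \<ge> 1"
    and "alpha_plus (symbolic_power Z (m + 1)) = alpha_plus (symbolic_power Z m) + 1"
  shows "(\<exists>p. Z \<subseteq> vertical_fiber p) \<or> (\<exists>q. Z \<subseteq> horizontal_fiber q)"
proof (rule ccontr)
  assume "\<not> ?thesis"
  then have nv: "\<not> Z \<subseteq> vertical_fiber p" and nh: "\<not> Z \<subseteq> horizontal_fiber p" for p by auto
  have "Z \<noteq> {}" using nv by blast
  obtain r where r: "\<forall>p\<in>fst ` Z \<union> snd ` Z. finite_in r p"
    using exists_finite_in[of "fst ` Z \<union> snd ` Z"] \<open>finite Z\<close> by auto
  then have fin: "finite_in r (fst P) \<and> finite_in r (snd P)" if "P \<in> Z" for P
    using that by auto
  define pt where "pt P = (coord r (fst P), coord r (snd P))" for P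
  have nx: "\<exists>P\<in>pt ` Z. fst P \<noteq> t" for t
  proof (rule ccontr)
    assume "\<not> ?thesis"
    then have *: "coord r (fst P) = t" if "P \<in> Z" for P using that by (auto simp: pt_def)
    obtain P0 where "P0 \<in> Z" using \<open>Z \<noteq> {}\<close> by blast
    then have "fst P = fst P0" if "P \<in> Z" for P
      using coord_inj[of r "fst P" "fst P0"] fin * that by simp
    then have "Z \<subseteq> vertical_fiber (fst P0)"
      unfolding vertical_fiber_def by blast
    with nv show False by blast
  qed
  have ny: "\<exists>P\<in>pt ` Z. snd P \<noteq> t" for t
  proof (rule ccontr)
    assume "\<not> ?thesis"
    then have *: "coord r (snd P) = t" if "P \<in> Z" for P using that by (auto simp: pt_def)
    obtain P0 where "P0 \<in> Z" using \<open>Z \<noteq> {}\<close> by blast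
    then have "snd P = snd P0" if "P \<in> Z" for P
      using coord_inj[of r "snd P" "snd P0"] fin * that by simp
    then have "Z \<subseteq> horizontal_fiber (snd P0)"
      unfolding horizontal_fiber_def by blast
    with nh show False by blast
  qed
  define A where "A k n \<longleftrightarrow> (\<exists>k1 k2. n = k1 + k2 \<and> (\<exists>F\<in>symbolic_power Z k. F \<noteq> 0 \<and> bihomogeneous k1 k2 F))"
    for k n
  have alpha: "alpha_plus (symbolic_power Z k) = (LEAST n. A k n)" for k
    by (simp add: alpha_plus_def A_def)
  \<comment> \<open>Affine polynomials yield upper bounds for \<open>alpha_plus\<close>:
    homogenization can be done in bidegree exactly \<open>(xdeg f, ydeg f)\<close>.\<close>
  have A_I: "A k (xdeg f + ydeg f)" if nz: "f \<noteq> 0" and van: "\<And>P. P \<in> pt ` Z \<Longrightarrow> vanish P k f" for f k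
  proof -
    obtain F where F: "F \<in> symbolic_power Z k" "bihomogeneous (xdeg f) (ydeg f) F" "chart r F = f"
      using homogenization[of f "xdeg f" "ydeg f" Z r k] \<open>Z \<noteq> {}\<close> fin van by (auto simp: pt_def)
    then have "F \<noteq> 0" using nz by (auto simp: chart_hom)
    with F show ?thesis unfolding A_def by blast
  qed
  have "A (m + 1) (LEAST n. A (m + 1) n)"
  proof (rule LeastI)
    \<comment> \<open>Vertical lines through all the points, each with exponent
      \<open>m + 1\<close>, show that the set whose least element is taken is not empty.\<close>
    let ?f = "\<Prod>P\<in>pt ` Z. xline (fst P) ^ (m + 1)"
    show "A (m + 1) (xdeg ?f + ydeg ?f)"
    proof (rule A_I)
      show "?f \<noteq> 0" using \<open>finite Z\<close> by simp
      fix P assume "P \<in> pt ` Z"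
      then have "?f = xline (fst P) ^ (m + 1) * (\<Prod>P\<in>pt ` Z - {P}. xline (fst P) ^ (m + 1))"
        using \<open>finite Z\<close> by (intro prod.remove) auto
      moreover have "vanish P (m + 1) (xline (fst P) ^ (m + 1))"
        using vanish_lines[of P "m + 1" 0] by simp
      ultimately show "vanish P (m + 1) ?f" by (simp only: vanish_mult_left)
    qed
  qed
  then obtain k1 k2 F where F: "(LEAST n. A (m + 1) n) = k1 + k2" "F \<in> symbolic_power Z (m + 1)"
    "F \<noteq> 0" "bihomogeneous k1 k2 F"
    unfolding A_def[of "m + 1" "LEAST n. A (m + 1) n"] by blast
  have "chart r F \<noteq> 0" using chart_eq_0D[OF F(4)] F(3) by blast
  moreover have "vanish P (m + 1) (chart r F)" if "P \<in> pt ` Z" for P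
  proof -
    from that obtain Q where Q: "Q \<in> Z" "P = pt Q" by blast
    then have "F \<in> point_ideal (fst Q) (snd Q) [^]\<^bsub>ideals_set bipoly_ring\<^esub> (m + 1)"
      using F(2) by (simp add: symbolic_power_def)
    with vanish_chart_power fin[OF Q(1)] Q(2) show ?thesis unfolding pt_def by blast
  qed
  ultimately obtain g where g: "g \<noteq> 0" "xdeg g + ydeg g + 2 \<le> xdeg (chart r F) + ydeg (chart r F)"
     "\<And>P. P \<in> pt ` Z \<Longrightarrow> vanish P m g"
    using affine_reduction[of "chart r F" "pt ` Z" m] nx ny \<open>finite Z\<close> by blast
  have "alpha_plus (symbolic_power Z m) \<le> xdeg g + ydeg g"
    unfolding alpha by (intro Least_le A_I g)
  \<comment> \<open>Passing to the chart does not raise the degrees, so the drop by 2 is a drop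
    below the minimal total degree \<open>k1 + k2\<close> for \<open>m + 1\<close>.\<close>
  also have "\<dots> + 2 \<le> k1 + k2"
    using g(2) degree_chart_le[OF F(4), of r] by simp
  finally show False
    using assms(3) F(1) by (simp add: alpha)
qed

end
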